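(* Let $K \subseteq \mathbb{R}^n$ be a convex body. Then there exist a linear subspace $U \subseteq \mathbb{R}^n$ (possibly $U = \mathbb{R}^n$) and a linear projection $\pi : \mathbb{R}^n \to U$ such that $d_{BM}(\pi(K), \mathbb{B}^n \cap U) = d_{BM}(K, \mathbb{B}^n)$ and the pair of distance ellipsoids for $\pi(K)$ is unique. Moreover, if $K$ has a pair of Euclidean balls as distance ellipsoids, then $\pi$ can be chosen to be the orthogonal projection onto $U$.
   Context: A convex body in $\mathbb{R}^n$ is a compact convex set with non-empty interior. $\mathbb{B}^n$ is the (closed) Euclidean unit ball in $\mathbb{R}^n$. The Banach--Mazur distance of convex bodies $K, L \subseteq \mathbb{R}^n$ is $$d_{BM}(K,L) := \inf \{ \rho \geq 0 : K + u \subseteq T(L + v) \subseteq \rho (K + u) \},$$ where the infimum runs over all invertible linear operators $T$ on $\mathbb{R}^n$ and all translation vectors $u, v \in \mathbb{R}^n$. The Banach--Mazur distance of lower-dimensional convex bodies is understood with respect to their common linear span (here $U$). A pair of ellipsoids $(E,F)$ is a pair of distance ellipsoids for a convex body $K \subseteq \mathbb{R}^n$ if $E$ and $F$ are homothetic with ratio $d_{BM}(K, \mathbb{B}^n)$ (that is, $F$ is a translate of $d_{BM}(K,\mathbb{B}^n)\, E$) and $E \subseteq K \subseteq F$. The centers of $E$ and $F$ may be placed arbitrarily and need not coincide. For $\pi(K)$, the notion is understood within $U$ (ellipsoids in $U$, with $\mathbb{B}^n \cap U$ in place of $\mathbb{B}^n$). *)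

theory Defs
  imports "HOL-Analysis.Analysis"
begin

definition convex_body :: "'a::euclidean_space set \<Rightarrow> bool" where
  "convex_body K \<longleftrightarrow> compact K \<and> convex K \<and> interior K \<noteq> {}"

text \<open>The notions below are relative to a linear subspace \<open>U\<close>; the case \<open>U = UNIV\<close> is the
  one of the ambient space. Invertible linear operators on \<open>U\<close> are represented
  by linear maps of the whole space that restrict to a bijection of \<open>U\<close> (every linear operator on
  \<open>U\<close> has such an extension).\<close>

definition linear_automorphism_on ::
    "'a::euclidean_space set \<Rightarrow> ('a \<Rightarrow> 'a) \<Rightarrow> bool" where
  "linear_automorphism_on U T \<longleftrightarrow> linear T \<and> bij_betw T U U"

definition banach_mazur_dist ::
    "'a::euclidean_space set \<Rightarrow> 'a set \<Rightarrow> 'a set \<Rightarrow> real" where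
  "banach_mazur_dist U K L =
     Inf {\<rho>. \<rho> \<ge> 0 \<and> (\<exists>T. linear_automorphism_on U T \<and> (\<exists>u\<in>U. \<exists>v\<in>U.
            (+) u ` K \<subseteq> T ` ((+) v ` L) \<and>
            T ` ((+) v ` L) \<subseteq> (*\<^sub>R) \<rho> ` ((+) u ` K)))}"

text \<open>Ellipsoids are solid and non-degenerate in \<open>U\<close>.\<close>

definition ellipsoid_in :: "'a::euclidean_space set \<Rightarrow> 'a set \<Rightarrow> bool" where
  "ellipsoid_in U E \<longleftrightarrow>
     (\<exists>T. linear_automorphism_on U T \<and> (\<exists>c\<in>U. E = (+) c ` T ` (cball 0 1 \<inter> U)))"

definition distance_ellipsoids ::
    "'a::euclidean_space set \<Rightarrow> 'a set \<Rightarrow> 'a set \<times> 'a set \<Rightarrow> bool" where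
  "distance_ellipsoids U K = (\<lambda>(E, F).
     ellipsoid_in U E \<and> ellipsoid_in U F \<and>
     (\<exists>t. F = (+) t ` (*\<^sub>R) (banach_mazur_dist U K (cball 0 1 \<inter> U)) ` E) \<and>
     E \<subseteq> K \<and> K \<subseteq> F)"

definition linear_projection_onto ::
    "'a::euclidean_space set \<Rightarrow> ('a \<Rightarrow> 'a) \<Rightarrow> bool" where
  "linear_projection_onto U \<pi> \<longleftrightarrow> linear \<pi> \<and> range \<pi> = U \<and> (\<forall>x\<in>U. \<pi> x = x)"

definition orthogonal_projection_onto ::
    "'a::euclidean_space set \<Rightarrow> ('a \<Rightarrow> 'a) \<Rightarrow> bool" where
  "orthogonal_projection_onto U \<pi> \<longleftrightarrow>
     linear_projection_onto U \<pi> \<and> (\<forall>x. \<forall>y\<in>U. orthogonal (x - \<pi> x) y)"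

end

theory Submission
  imports Defs
begin

text \<open>
  A pair of homothetic ellipsoids around \<open>K\<close> is given by a gauge \<open>norm (S x)\<close>, an inner centre, an outer centre
  and the ratio \<open>\<rho>\<close>; call such data a sandwich. The distance from \<open>K\<close> to the ball is the least ratio of a
  sandwich (\<open>banach_mazur_dist_ball\<close>), it is attained (\<open>optimal_sandwich_exists\<close>), and the distance ellipsoids
  are the optimal sandwiches (\<open>distance_ellipsoids_iff\<close>).

  After a linear change of coordinates one optimal sandwich consists of balls. An orthogonal projection
  maps it to a pair of balls with the same ratio, so it does not increase the distance. Among all orthogonal
  projections that preserve the distance take one whose image \<open>U\<close> has minimal dimension. The claim is that the
  pair of distance ellipsoids of the projected body is unique (\<open>unique_orthogonal_projection\<close>).

  Suppose that there is a second pair. Diagonalize it in an orthonormal basis and average the two pairs: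
  the inner ellipsoids by Minkowski combination, which averages the semi-axes, and the outer ones by
  averaging the quadratic inequalities, which averages the inverse squares of the semi-axes. The second mean
  of semi-axes is at most the first one, with strict inequality where the semi-axes differ. Optimality
  excludes different outer centres, and different inner centres make the inner average longer in the
  direction between them. In each case an optimal sandwich arises in which some direction \<open>v\<close> has strict slack
  (\<open>strict_sandwich_of_two_sandwiches\<close>).

  By minimality of \<open>U\<close>, projecting further along \<open>v\<close> strictly decreases the distance. Mixing a small portion
  \<open>\<epsilon>\<close> of the better pair in the hyperplane into the averaged pair improves the ratio in the
  hyperplane by a relative amount of order \<open>\<epsilon>\<close>. Lifting the inner ellipsoid from the projection to the body
  costs a relative amount of order \<open>\<epsilon>\<^sup>2\<close> only, because of the slack along \<open>v\<close> (\<open>better_ratio_from_hyperplane\<close>). The resulting ratio is smaller than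
  the distance, a contradiction.

  Undoing the change of coordinates turns the orthogonal projection into a linear one
  (\<open>unique_linear_projection\<close>); if balls are distance ellipsoids from the start, no change of coordinates is made.
\<close>

section \<open>Diagonal maps and the singular value decomposition\<close>

definition orthonormal_basis :: "'a::euclidean_space set \<Rightarrow> 'a set \<Rightarrow> bool" where
  "orthonormal_basis B U \<longleftrightarrow>
     finite B \<and> span B = U \<and> (\<forall>a\<in>B. \<forall>b\<in>B. a \<bullet> b = (if a = b then 1 else 0))"

definition diag :: "'a::euclidean_space set \<Rightarrow> ('a \<Rightarrow> real) \<Rightarrow> 'a \<Rightarrow> 'a" where
  "diag B f x = (\<Sum>b\<in>B. (f b * (x \<bullet> b)) *\<^sub>R b)"

lemma linear_diag [simp]: "linear (diag B f)"
  unfolding diag_def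
  by (intro linear_compose_sum ballI) (auto intro!: linearI simp: inner_add_left algebra_simps)

context
  fixes B U :: "'a::euclidean_space set"
  assumes B: "orthonormal_basis B U"
begin

lemma orthonormal_basis_finite: "finite B" and orthonormal_basis_span: "span B = U"
  and orthonormal_basis_inner: "a \<in> B \<Longrightarrow> b \<in> B \<Longrightarrow> a \<bullet> b = (if a = b then 1 else 0)"
  using B by (auto simp: orthonormal_basis_def)

lemma orthonormal_basis_subspace: "subspace U"
  using orthonormal_basis_span by auto

lemma orthonormal_basis_mem: "b \<in> B \<Longrightarrow> b \<in> U"
  using orthonormal_basis_span span_base by auto

lemma diag_mem: "diag B f x \<in> U"
  unfolding diag_def
  by (intro subspace_sum subspace_scale orthonormal_basis_subspace orthonormal_basis_mem)

lemma diag_inner: "b \<in> B \<Longrightarrow> diag B f x \<bullet> b = f b * (x \<bullet> b)"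
proof -
  assume b: "b \<in> B"
  have "diag B f x \<bullet> b = (\<Sum>a\<in>B. if a = b then f b * (x \<bullet> b) else 0)"
    unfolding diag_def inner_sum_left
    by (intro sum.cong refl) (auto simp: orthonormal_basis_inner b)
  then show ?thesis using b orthonormal_basis_finite by simp
qed

lemma orthonormal_basis_eqI:
  assumes "x \<in> U" "y \<in> U" "\<And>b. b \<in> B \<Longrightarrow> x \<bullet> b = y \<bullet> b"
  shows "x = y"
proof -
  have "x - y \<in> span B"
    using assms orthonormal_basis_span orthonormal_basis_subspace by (simp add: subspace_diff)
  then have "orthogonal (x - y) (x - y)"
    by (rule orthogonal_to_span) (simp add: orthogonal_def inner_diff_left assms(3))
  then show ?thesis by (simp add: orthogonal_def)
qed

lemma diag_one: "x \<in> U \<Longrightarrow> diag B (\<lambda>b. 1) x = x"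
  by (rule orthonormal_basis_eqI) (auto simp: diag_mem diag_inner)

lemma norm_diag: "(norm (diag B f x))\<^sup>2 = (\<Sum>b\<in>B. (f b * (x \<bullet> b))\<^sup>2)"
proof -
  have "(norm (diag B f x))\<^sup>2 = (\<Sum>b\<in>B. f b * (x \<bullet> b) * (diag B f x \<bullet> b))"
    unfolding power2_norm_eq_inner
    by (subst (2) diag_def) (simp add: inner_sum_right)
  then show ?thesis by (simp add: diag_inner power2_eq_square)
qed

lemma norm_orthonormal_basis: "x \<in> U \<Longrightarrow> (norm x)\<^sup>2 = (\<Sum>b\<in>B. (x \<bullet> b)\<^sup>2)"
  using norm_diag[of "\<lambda>b. 1" x] by (simp add: diag_one)

lemma diag_inverse:
  assumes "\<And>b. b \<in> B \<Longrightarrow> f b \<noteq> 0" "x \<in> U"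
  shows "diag B f (diag B (\<lambda>b. 1 / f b) x) = x" "diag B (\<lambda>b. 1 / f b) (diag B f x) = x"
  using assms by (auto intro!: orthonormal_basis_eqI simp: diag_mem diag_inner)

lemma inj_on_diag:
  assumes "\<And>b. b \<in> B \<Longrightarrow> f b \<noteq> 0"
  shows "inj_on (diag B f) U"
  by (rule inj_on_inverseI[where g = "diag B (\<lambda>b. 1 / f b)"]) (use assms in \<open>simp add: diag_inverse\<close>)

lemma diag_image:
  assumes "\<And>b. b \<in> B \<Longrightarrow> f b \<noteq> 0"
  shows "diag B f ` U = U"
proof
  show "U \<subseteq> diag B f ` U"
  proof
    fix x assume "x \<in> U"
    then have "x = diag B f (diag B (\<lambda>b. 1 / f b) x)" using assms by (simp add: diag_inverse)
    then show "x \<in> diag B f ` U" using diag_mem by blast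
  qed
qed (auto simp: diag_mem)

end

lemma coordinates_inner:
  assumes "orthonormal_basis B U" "b \<in> B"
  shows "(\<Sum>a\<in>B. h a *\<^sub>R a) \<bullet> b = h b"
proof -
  have "(\<Sum>a\<in>B. h a *\<^sub>R a) \<bullet> b = (\<Sum>a\<in>B. if a = b then h b else 0)"
    unfolding inner_sum_left
    by (intro sum.cong refl) (auto simp: orthonormal_basis_inner[OF assms(1)] assms(2))
  then show ?thesis using assms(2) orthonormal_basis_finite[OF assms(1)] by simp
qed

lemma coordinates_mem:
  assumes "orthonormal_basis B U"
  shows "(\<Sum>a\<in>B. h a *\<^sub>R a) \<in> U"
  by (intro subspace_sum subspace_scale orthonormal_basis_subspace[OF assms] orthonormal_basis_mem[OF assms])

lemma orthonormal_basis_insert: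
  assumes U: "subspace U" and e: "e \<in> U" "norm e = 1"
    and B: "orthonormal_basis B {x \<in> U. x \<bullet> e = 0}"
  shows "orthonormal_basis (insert e B) U" "e \<notin> B"
proof -
  note fin = orthonormal_basis_finite[OF B] and mem = orthonormal_basis_mem[OF B]
  have ee: "e \<bullet> e = 1" using e by (simp add: dot_square_norm)
  show "e \<notin> B" using mem[of e] ee by auto
  have sub: "insert e B \<subseteq> U" using mem e by auto
  have "x \<in> span (insert e B)" if "x \<in> U" for x
  proof -
    have "x - (x \<bullet> e) *\<^sub>R e \<in> {x \<in> U. x \<bullet> e = 0}"
      using that U e ee by (auto simp: subspace_diff subspace_scale inner_diff_left)
    then have "x - (x \<bullet> e) *\<^sub>R e \<in> span B" by (simp add: orthonormal_basis_span[OF B])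
    then show ?thesis by (auto simp: span_breakdown_eq)
  qed
  then have "span (insert e B) = U"
    using span_minimal[OF sub U] by auto
  then show "orthonormal_basis (insert e B) U"
    using fin mem ee orthonormal_basis_inner[OF B] \<open>e \<notin> B\<close>
    unfolding orthonormal_basis_def by (auto simp: inner_commute)
qed

lemma dim_hyperplane_section_less:
  fixes e :: "'a::euclidean_space"
  assumes U: "subspace U" and e: "e \<in> U" "norm e = 1"
  shows "subspace {x \<in> U. x \<bullet> e = 0}" "dim {x \<in> U. x \<bullet> e = 0} < dim U"
proof -
  show sub: "subspace {x \<in> U. x \<bullet> e = 0}"
    using U by (auto simp: subspace_def inner_add_left)
  have "e \<notin> {x \<in> U. x \<bullet> e = 0}" using e by (auto simp: dot_square_norm)
  then have "{x \<in> U. x \<bullet> e = 0} \<subset> U" using e by blast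
  then show "dim {x \<in> U. x \<bullet> e = 0} < dim U"
    by (intro dim_psubset) (simp only: span_eq_iff[THEN iffD2, OF sub] span_eq_iff[THEN iffD2, OF U])
qed

text \<open>The singular value decomposition in geometric form. A unit vector \<open>e\<close> of \<open>U\<close> at which \<open>norm (S e)\<close> is
maximal has image orthogonal to the image of its orthogonal complement, so that the construction
continues in that complement.\<close>

lemma singular_basis:
  fixes S :: "'a::euclidean_space \<Rightarrow> 'b::real_inner"
  assumes "subspace U" and S: "linear S"
  shows "\<exists>B. orthonormal_basis B U \<and> (\<forall>a\<in>B. \<forall>b\<in>B. a \<noteq> b \<longrightarrow> S a \<bullet> S b = 0)"
  using assms(1)
proof (induction "dim U" arbitrary: U rule: less_induct)
  case less
  note U = less.prems
  show ?case
  proof (cases "U = {0}")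
    case True
    then have "orthonormal_basis {} U" by (simp add: orthonormal_basis_def)
    then show ?thesis by blast
  next
    case False
    then obtain y0 where y0: "y0 \<in> U" "y0 \<noteq> 0" using subspace_0[OF U] by blast
    have "compact (sphere 0 1 \<inter> U)" by (simp add: closed_subspace[OF U] compact_Int_closed)
    moreover have "y0 /\<^sub>R norm y0 \<in> sphere 0 1 \<inter> U"
      using y0 U by (auto simp: subspace_scale)
    moreover have "continuous_on (sphere 0 1 \<inter> U) (\<lambda>x. norm (S x))"
      by (intro continuous_intros linear_continuous_on[OF linear_conv_bounded_linear[THEN iffD1, OF S]])
    ultimately obtain e where e: "e \<in> U" "norm e = 1"
      and max: "\<And>y. y \<in> U \<Longrightarrow> norm y = 1 \<Longrightarrow> norm (S y) \<le> norm (S e)"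
      using continuous_attains_sup[of "sphere 0 1 \<inter> U" "\<lambda>x. norm (S x)"] by force
    have ee: "e \<bullet> e = 1" using e by (simp add: dot_square_norm)
    have max': "norm (S y) \<le> norm (S e) * norm y" if "y \<in> U" for y
    proof (cases "y = 0")
      case False
      with that have "norm (S (y /\<^sub>R norm y)) \<le> norm (S e)"
        by (intro max) (auto simp: U subspace_scale)
      then show ?thesis using False by (simp add: linear_scale[OF S] field_simps)
    qed (simp add: linear_0[OF S])
    \<comment> \<open>Maximality of \<open>norm (S e)\<close> on the unit sphere kills the first variation in every direction
        orthogonal to \<open>e\<close>.\<close>
    have orth: "S e \<bullet> S y = 0" if y: "y \<in> U" "y \<bullet> e = 0" for y
    proof (rule ccontr)
      define m where "m = S e \<bullet> S y"
      define N where "N = (norm (S e))\<^sup>2 * (norm y)\<^sup>2"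
      assume "S e \<bullet> S y \<noteq> 0"
      then have m: "m \<noteq> 0" by (simp add: m_def)
      have N: "N \<ge> 0" by (simp add: N_def)
      define t where "t = m / (N + 1)"
      have "(norm (S (e + t *\<^sub>R y)))\<^sup>2 \<le> (norm (S e) * norm (e + t *\<^sub>R y))\<^sup>2"
        using y e U by (intro power_mono max') (auto simp: subspace_add subspace_scale)
      also have "\<dots> = (norm (S e))\<^sup>2 * (1 + t\<^sup>2 * (norm y)\<^sup>2)"
        using y ee by (simp add: power_mult_distrib power2_norm_eq_inner inner_add_left
            inner_add_right inner_commute) (simp add: power2_eq_square)
      finally have "(norm (S e))\<^sup>2 + 2 * t * m + t\<^sup>2 * (norm (S y))\<^sup>2 \<le> (norm (S e))\<^sup>2 + t\<^sup>2 * N"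
        unfolding power2_norm_eq_inner m_def N_def
        by (simp add: linear_add[OF S] linear_scale[OF S] inner_add_left
            inner_add_right inner_commute[of "S y" "S e"] algebra_simps)
          (simp add: power2_eq_square algebra_simps)
      moreover have "0 \<le> t\<^sup>2 * (norm (S y))\<^sup>2" by simp
      ultimately have "2 * t * m \<le> t\<^sup>2 * N" by linarith
      also have "\<dots> \<le> t\<^sup>2 * (N + 1)" by (simp add: mult_left_mono)
      also have "\<dots> = t * (t * (N + 1))" by (simp only: power2_eq_square mult.assoc)
      also have "t * (N + 1) = m" using N by (simp add: t_def)
      finally have "t * m \<le> 0" by linarith
      moreover have "0 < m\<^sup>2 / (N + 1)" using m N by (intro divide_pos_pos) auto
      moreover have "t * m = m\<^sup>2 / (N + 1)" by (simp add: t_def power2_eq_square)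
      ultimately show False by simp
    qed
    define W where "W = {x \<in> U. x \<bullet> e = 0}"
    have "subspace W" "dim W < dim U"
      unfolding W_def using dim_hyperplane_section_less[OF U e] by auto
    from less.hyps[OF this(2,1)] obtain B where B: "orthonormal_basis B W"
      "\<forall>a\<in>B. \<forall>b\<in>B. a \<noteq> b \<longrightarrow> S a \<bullet> S b = 0" by blast
    have "orthonormal_basis (insert e B) U"
      using orthonormal_basis_insert(1)[OF U e] B(1) by (simp add: W_def)
    moreover have "S e \<bullet> S b = 0" if "b \<in> B" for b
      using orthonormal_basis_mem[OF B(1) that] orth by (auto simp: W_def)
    ultimately show ?thesis using B(2) by (auto intro!: exI[of _ "insert e B"] simp: inner_commute)
  qed
qed

text \<open>Every Euclidean gauge \<open>norm (S x)\<close> on \<open>U\<close> is diagonal in a suitable orthonormal basis; the numbers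
\<open>f b\<close> are the inverse semi-axes of the unit ball of the gauge.\<close>

lemma diagonalization:
  fixes S :: "'a::euclidean_space \<Rightarrow> 'b::real_inner"
  assumes U: "subspace U" and S: "linear S" "inj_on S U"
  obtains B f where "orthonormal_basis B U" "\<And>b. b \<in> B \<Longrightarrow> 0 < (f b :: real)"
    "\<And>x. x \<in> U \<Longrightarrow> norm (S x) = norm (diag B f x)"
proof -
  obtain B where B: "orthonormal_basis B U"
    and orth: "\<And>a b. a \<in> B \<Longrightarrow> b \<in> B \<Longrightarrow> a \<noteq> b \<Longrightarrow> S a \<bullet> S b = 0"
    using singular_basis[OF U S(1)] by blast
  have "0 < norm (S b)" if "b \<in> B" for b
  proof -
    have "b \<noteq> 0" using orthonormal_basis_inner[OF B that that] by auto
    moreover have "b \<in> U" "0 \<in> U" using orthonormal_basis_mem[OF B that] subspace_0[OF U] .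
    ultimately have "S b \<noteq> 0" using S by (metis inj_onD linear_0)
    then show ?thesis by simp
  qed
  moreover have "norm (S x) = norm (diag B (\<lambda>b. norm (S b)) x)" if "x \<in> U" for x
  proof -
    have "S x = S (diag B (\<lambda>b. 1) x)" by (simp add: diag_one[OF B that])
    also have "\<dots> = (\<Sum>b\<in>B. (x \<bullet> b) *\<^sub>R S b)"
      by (simp add: diag_def linear_sum[OF S(1)] linear_scale[OF S(1)])
    finally have Sx: "S x = (\<Sum>b\<in>B. (x \<bullet> b) *\<^sub>R S b)" .
    have "(norm (S x))\<^sup>2 = (\<Sum>b\<in>B. (norm ((x \<bullet> b) *\<^sub>R S b))\<^sup>2)"
      unfolding Sx by (rule norm_sum_Pythagorean)
        (auto simp: orthonormal_basis_finite[OF B] pairwise_def orthogonal_def orth)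
    also have "\<dots> = (norm (diag B (\<lambda>b. norm (S b)) x))\<^sup>2"
      by (simp add: norm_diag[OF B] power_mult_distrib mult.commute)
    finally show ?thesis by simp
  qed
  ultimately show ?thesis by (intro that[OF B])
qed

section \<open>Ellipsoids and the distance to the ball\<close>

lemma automorphism_left_inverse:
  assumes U: "subspace U" and T: "linear_automorphism_on U T"
  obtains S where "linear S" "inj_on S U" "\<And>y. S y \<in> U" "\<And>y. y \<in> U \<Longrightarrow> S (T y) = y"
    "\<And>x. x \<in> U \<Longrightarrow> T (S x) = x"
proof -
  have T': "linear T" "inj_on T U" "T ` U = U"
    using T by (auto simp: linear_automorphism_on_def bij_betw_def)
  then obtain S where S: "range S \<subseteq> U" "linear S" "\<And>y. y \<in> U \<Longrightarrow> S (T y) = y"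
    using linear_inj_on_left_inverse[of T U] U by (metis span_eq_iff)
  have TS: "T (S x) = x" if "x \<in> U" for x
    using that T'(3) S(3) by force
  have "inj_on S U" by (rule inj_on_inverseI[of U T]) (rule TS)
  then show ?thesis using that S TS by blast
qed

lemma injective_map_isometry:
  fixes S :: "'a::euclidean_space \<Rightarrow> 'b::real_inner"
  assumes U: "subspace U" and S: "linear S" "inj_on S U"
  obtains T where "linear_automorphism_on U T" "\<And>y. y \<in> U \<Longrightarrow> norm (S (T y)) = norm y"
proof -
  obtain B f where B: "orthonormal_basis B U" and f: "\<And>b. b \<in> B \<Longrightarrow> 0 < (f b :: real)"
    and n: "\<And>x. x \<in> U \<Longrightarrow> norm (S x) = norm (diag B f x)"
    using diagonalization[OF U S] by metis
  \<comment> \<open>\<open>S\<close> stretches the basis vector \<open>b\<close> by \<open>f b\<close> and keeps the basis orthogonal; \<open>T\<close> undoes the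
      stretching.\<close>
  let ?T = "diag B (\<lambda>b. 1 / f b)"
  have "linear_automorphism_on U ?T"
    unfolding linear_automorphism_on_def bij_betw_def
    by (intro conjI linear_diag inj_on_diag[OF B] diag_image[OF B]) (auto dest: f)
  moreover have "norm (S (?T y)) = norm y" if "y \<in> U" for y
    unfolding n[OF diag_mem[OF B]]
    by (subst diag_inverse(1)[OF B _ that]) (auto dest: f)
  ultimately show thesis by (rule that)
qed

text \<open>Ellipsoids are described by a gauge \<open>S\<close>, a centre and a radius. In this form two homothetic ellipsoids
share their gauge, and the outer inclusions are inequalities for all points of the body.\<close>

definition ellipsoid ::
    "'a::euclidean_space set \<Rightarrow> ('a \<Rightarrow> 'a) \<Rightarrow> 'a \<Rightarrow> real \<Rightarrow> 'a set" where
  "ellipsoid U S c r = {x \<in> U. norm (S (x - c)) \<le> r}"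

lemma automorphism_image_ball:
  assumes U: "subspace U" and T: "linear_automorphism_on U T" and c: "c \<in> U"
    and S: "\<And>y. y \<in> U \<Longrightarrow> norm (S (T y)) = norm y"
  shows "(+) c ` T ` (cball 0 1 \<inter> U) = ellipsoid U S c 1"
proof -
  have TU: "T ` U = U" using T by (auto simp: linear_automorphism_on_def bij_betw_def)
  then have "T y \<in> U" if "y \<in> U" for y using that by blast
  note TU = TU this
  show ?thesis
  proof (intro set_eqI iffI)
    fix x assume "x \<in> (+) c ` T ` (cball 0 1 \<inter> U)"
    then obtain y where "x = c + T y" "y \<in> U" "norm y \<le> 1" by auto
    then show "x \<in> ellipsoid U S c 1"
      using S TU U c by (auto simp: ellipsoid_def subspace_add)
  next
    fix x assume x: "x \<in> ellipsoid U S c 1"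
    then have "x - c \<in> U" using U c by (auto simp: ellipsoid_def subspace_diff)
    then obtain y where y: "y \<in> U" "x - c = T y" using TU by blast
    then have "norm y \<le> 1" using x S[OF y(1)] by (simp add: ellipsoid_def)
    then show "x \<in> (+) c ` T ` (cball 0 1 \<inter> U)"
      using y by (intro image_eqI[of _ _ "T y"] image_eqI[of _ _ y]) (auto simp: algebra_simps)
  qed
qed

text \<open>The passage from images of the unit ball to gauges. The direction from right to left rests on
\<open>injective_map_isometry\<close>, since \<open>S\<close> need not map \<open>U\<close> into itself.\<close>

lemma ellipsoid_in_iff:
  assumes U: "subspace U"
  shows "ellipsoid_in U E \<longleftrightarrow> (\<exists>S c. linear S \<and> inj_on S U \<and> c \<in> U \<and> E = ellipsoid U S c 1)"
proof
  assume "ellipsoid_in U E"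
  then obtain T c where T: "linear_automorphism_on U T" and c: "c \<in> U"
    and E: "E = (+) c ` T ` (cball 0 1 \<inter> U)"
    by (auto simp: ellipsoid_in_def)
  from automorphism_left_inverse[OF U T] obtain S
    where S: "linear S" "inj_on S U" "\<And>y. y \<in> U \<Longrightarrow> S (T y) = y" by metis
  show "\<exists>S c. linear S \<and> inj_on S U \<and> c \<in> U \<and> E = ellipsoid U S c 1"
    using S c automorphism_image_ball[OF U T c, of S] unfolding E by auto
next
  assume "\<exists>S c. linear S \<and> inj_on S U \<and> c \<in> U \<and> E = ellipsoid U S c 1"
  then obtain S c where S: "linear S" "inj_on S U" and c: "c \<in> U" and E: "E = ellipsoid U S c 1"
    by blast
  from injective_map_isometry[OF U S] obtain T
    where T: "linear_automorphism_on U T" "\<And>y. y \<in> U \<Longrightarrow> norm (S (T y)) = norm y" by blast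
  show "ellipsoid_in U E"
    unfolding ellipsoid_in_def E using T c automorphism_image_ball[OF U T(1) c T(2)] by blast
qed

text \<open>A pair of homothetic ellipsoids with ratio \<open>\<rho>\<close> around \<open>K\<close>, with inner centre \<open>c\<close> and outer centre
\<open>c'\<close>. For the optimal \<open>\<rho>\<close> these are the pairs of distance ellipsoids.\<close>

definition sandwich ::
    "'a::euclidean_space set \<Rightarrow> 'a set \<Rightarrow> ('a \<Rightarrow> 'a) \<Rightarrow> 'a \<Rightarrow> 'a \<Rightarrow> real \<Rightarrow> bool" where
  "sandwich U K S c c' \<rho> \<longleftrightarrow> linear S \<and> inj_on S U \<and> c \<in> U \<and> c' \<in> U \<and>
     ellipsoid U S c 1 \<subseteq> K \<and> K \<subseteq> ellipsoid U S c' \<rho>"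

lemma sandwich_center: "sandwich U K S c c' \<rho> \<Longrightarrow> c \<in> K"
  by (auto simp: sandwich_def ellipsoid_def linear_0)

lemma sandwich_nonneg: "sandwich U K S c c' \<rho> \<Longrightarrow> 0 \<le> \<rho>"
  using sandwich_center[of U K S c c' \<rho>] order_trans[OF norm_ge_zero]
  by (fastforce simp: sandwich_def ellipsoid_def)

lemma sandwich_mono: "sandwich U K S c c' \<rho> \<Longrightarrow> \<rho> \<le> \<rho>' \<Longrightarrow> sandwich U K S c c' \<rho>'"
  by (fastforce simp: sandwich_def ellipsoid_def)

lemma sandwich_ratio:
  assumes U: "subspace U" "U \<noteq> {0}" and s: "sandwich U K S c c' \<rho>"
  shows "1 \<le> \<rho>" "c \<noteq> c' \<Longrightarrow> 1 < \<rho>"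
proof -
  have S: "linear S" "inj_on S U" "c \<in> U" "c' \<in> U"
    and sub: "ellipsoid U S c 1 \<subseteq> ellipsoid U S c' \<rho>"
    using s by (auto simp: sandwich_def)
  have pos: "0 < norm (S e)" if "e \<in> U" "e \<noteq> 0" for e
    using that S subspace_0[OF U(1)] by (metis inj_onD linear_0 zero_less_norm_iff)
  \<comment> \<open>The point of the inner ellipsoid that lies farthest from \<open>c\<close> in the direction \<open>e\<close>, tested
      against the outer ellipsoid.\<close>
  have le: "norm (S (c - c') + S e /\<^sub>R norm (S e)) \<le> \<rho>" if e: "e \<in> U" "e \<noteq> 0" for e
  proof -
    have "c + e /\<^sub>R norm (S e) \<in> ellipsoid U S c 1"
      using U S e pos[OF e]
      by (auto simp: ellipsoid_def subspace_add subspace_scale linear_scale)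
    then have "norm (S (c + e /\<^sub>R norm (S e) - c')) \<le> \<rho>"
      using sub by (auto simp: ellipsoid_def)
    moreover have "S (c + e /\<^sub>R norm (S e) - c') = S (c - c') + S e /\<^sub>R norm (S e)"
      by (simp add: linear_add[OF S(1)] linear_diff[OF S(1)] linear_scale[OF S(1)])
    ultimately show ?thesis by simp
  qed
  \<comment> \<open>For distinct centers the direction from \<open>c'\<close> to \<open>c\<close> gives \<open>norm (S (c - c')) + 1 \<le> \<rho>\<close>.\<close>
  have *: "1 < \<rho>" if "c \<noteq> c'"
  proof -
    let ?e = "c - c'"
    have e: "?e \<in> U" "?e \<noteq> 0" using that S U by (auto simp: subspace_diff)
    have "S ?e + S ?e /\<^sub>R norm (S ?e) = (1 + inverse (norm (S ?e))) *\<^sub>R S ?e"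
      by (simp add: algebra_simps)
    then have "norm (S ?e + S ?e /\<^sub>R norm (S ?e)) = (1 + inverse (norm (S ?e))) * norm (S ?e)"
      by (simp only: norm_scaleR) simp
    also have "\<dots> = norm (S ?e) + 1"
      using pos[OF e] by (simp add: field_simps)
    finally show ?thesis using le[OF e] pos[OF e] by linarith
  qed
  then show "c \<noteq> c' \<Longrightarrow> 1 < \<rho>" .
  show "1 \<le> \<rho>"
  proof (cases "c = c'")
    case True
    obtain e where e: "e \<in> U" "e \<noteq> 0" using U subspace_0 by blast
    show ?thesis using le[OF e] pos[OF e] True by (simp add: linear_0[OF S(1)])
  qed (use * in simp)
qed

text \<open>The definition of the distance scales about the origin and moves the body and the ball by translations,
whereas the two centres of a sandwich are independent of each other. The two descriptions agree because
two homothetic sets of ratio different from 1 have a dilation centre, which translations can move to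
the origin; for ratio 1 an inclusion of translates of an ellipsoid forces equality.\<close>

lemma banach_mazur_dist_ball:
  assumes U: "subspace U" and K: "K \<noteq> {}"
  shows "banach_mazur_dist U K (cball 0 1 \<inter> U) = Inf {\<rho>. \<exists>S c c'. sandwich U K S c c' \<rho>}"
proof (cases "U = {0}")
  case True
  have id: "linear_automorphism_on {0} (\<lambda>x. x)"
    by (simp add: linear_automorphism_on_def bij_betw_def linear_id[unfolded id_def])
  have "(\<rho> \<ge> 0 \<and> (\<exists>T. linear_automorphism_on U T \<and> (\<exists>u\<in>U. \<exists>v\<in>U.
            (+) u ` K \<subseteq> T ` ((+) v ` (cball 0 1 \<inter> U)) \<and>
            T ` ((+) v ` (cball 0 1 \<inter> U)) \<subseteq> (*\<^sub>R) \<rho> ` ((+) u ` K)))) \<longleftrightarrow> K = {0} \<and> 0 \<le> \<rho>"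
    (is "?L \<longleftrightarrow> ?R") for \<rho>
  proof
    assume ?R
    then show ?L unfolding True by (intro conjI exI[of _ "\<lambda>x. x"]) (auto simp: id)
  next
    assume ?L
    then show ?R using K by (auto simp: True linear_automorphism_on_def linear_0)
  qed
  moreover have "(\<exists>S c c'. sandwich U K S c c' \<rho>) \<longleftrightarrow> K = {0} \<and> 0 \<le> \<rho>" (is "?L \<longleftrightarrow> ?R") for \<rho>
  proof
    assume ?R
    then show ?L unfolding True
      by (intro exI[of _ "\<lambda>x. x"] exI[of _ 0])
        (auto simp: sandwich_def ellipsoid_def linear_id[unfolded id_def])
  next
    assume L: ?L
    then have "K \<subseteq> {0}" by (auto simp: True sandwich_def ellipsoid_def)
    then show ?R using K L sandwich_nonneg by blast
  qed
  ultimately show ?thesis by (simp add: banach_mazur_dist_def)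
next
  case False
  have "(\<rho> \<ge> 0 \<and> (\<exists>T. linear_automorphism_on U T \<and> (\<exists>u\<in>U. \<exists>v\<in>U.
            (+) u ` K \<subseteq> T ` ((+) v ` (cball 0 1 \<inter> U)) \<and>
            T ` ((+) v ` (cball 0 1 \<inter> U)) \<subseteq> (*\<^sub>R) \<rho> ` ((+) u ` K))))
    \<longleftrightarrow> (\<exists>S c c'. sandwich U K S c c' \<rho>)" (is "?L \<longleftrightarrow> ?R") for \<rho>
  proof
    assume ?L
    then obtain T u v where \<rho>: "\<rho> \<ge> 0" and T: "linear_automorphism_on U T" and u: "u \<in> U" and v: "v \<in> U"
      and out: "(+) u ` K \<subseteq> T ` ((+) v ` (cball 0 1 \<inter> U))"
      and inn: "T ` ((+) v ` (cball 0 1 \<inter> U)) \<subseteq> (*\<^sub>R) \<rho> ` ((+) u ` K)" by blast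
    have lT: "linear T" and TU: "\<And>x. x \<in> U \<Longrightarrow> T x \<in> U"
      using T by (auto simp: linear_automorphism_on_def bij_betw_def)
    obtain S where S: "linear S" "inj_on S U" "\<And>y. S y \<in> U" "\<And>y. y \<in> U \<Longrightarrow> S (T y) = y"
      "\<And>x. x \<in> U \<Longrightarrow> T (S x) = x" using automorphism_left_inverse[OF U T] by blast
    have \<rho>0: "\<rho> \<noteq> 0"
    proof
      assume "\<rho> = 0"
      then have z: "T (v + y) = 0" if "y \<in> U" "norm y \<le> 1" for y using that inn by fastforce
      obtain e where e: "e \<in> U" "e \<noteq> 0" using False subspace_0[OF U] by blast
      let ?y = "e /\<^sub>R norm e"
      have y: "?y \<in> U" "norm ?y \<le> 1" using e U by (auto simp: subspace_scale)
      have "T ?y = 0" using z[OF y] z[of 0] subspace_0[OF U] by (simp add: linear_add[OF lT])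
      then have "?y = 0" using S(4)[OF y(1)] by (simp add: linear_0[OF S(1)])
      then show False using e by simp
    qed
    \<comment> \<open>The ellipsoid \<open>T (v + ball)\<close> is the outer one; the inner one is its image under division by
        \<open>\<rho>\<close>, so the unit ball of the inner gauge is \<open>T ball / \<rho>\<close>.\<close>
    let ?S = "\<lambda>x. \<rho> *\<^sub>R S x" and ?c = "T v /\<^sub>R \<rho> - u" and ?c' = "T v - u"
    have cU: "?c \<in> U" "?c' \<in> U" using U TU u v by (auto simp: subspace_diff subspace_scale)
    have "inj_on ?S U" using S(2) \<rho>0 by (auto simp: inj_on_def)
    moreover have "linear ?S" using S(1) by (rule linear_compose_scale_right)
    moreover have "ellipsoid U ?S ?c 1 \<subseteq> K"
    proof
      fix x assume x: "x \<in> ellipsoid U ?S ?c 1"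
      define y where "y = \<rho> *\<^sub>R S (x - ?c)"
      have y: "y \<in> U" "norm y \<le> 1"
        using x U S(3) by (auto simp: ellipsoid_def y_def subspace_scale)
      have "T y = \<rho> *\<^sub>R (x - ?c)"
        using x cU U by (simp add: y_def linear_scale[OF lT] S(5) ellipsoid_def subspace_diff)
      then have "T (v + y) = \<rho> *\<^sub>R (u + x)"
        using \<rho>0 by (simp add: linear_add[OF lT] algebra_simps)
      moreover have "T (v + y) \<in> T ` ((+) v ` (cball 0 1 \<inter> U))" using y by simp
      then have "T (v + y) \<in> (*\<^sub>R) \<rho> ` ((+) u ` K)" using inn by (rule subsetD[rotated])
      ultimately show "x \<in> K" using \<rho>0 by auto
    qed
    moreover have "K \<subseteq> ellipsoid U ?S ?c' \<rho>"
    proof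
      fix x assume "x \<in> K"
      then obtain y where y: "y \<in> U" "norm y \<le> 1" and ux: "u + x = T (v + y)" using out by force
      have x: "x = ?c' + T y" using ux by (simp add: linear_add[OF lT] algebra_simps)
      have "x \<in> U" unfolding x using cU TU y U by (simp add: subspace_add)
      moreover have "S (x - ?c') = y" unfolding x using y by (simp add: S(4))
      ultimately show "x \<in> ellipsoid U ?S ?c' \<rho>"
        using y \<rho> by (simp add: ellipsoid_def mult_left_le)
    qed
    ultimately have "sandwich U K ?S ?c ?c' \<rho>"
      unfolding sandwich_def using cU by (intro conjI)
    then show ?R by blast
  next
    assume ?R
    then obtain S c c' where s: "sandwich U K S c c' \<rho>" by blast
    have S: "linear S" "inj_on S U" and c: "c \<in> U" "c' \<in> U"
      and inn: "ellipsoid U S c 1 \<subseteq> K" and out: "K \<subseteq> ellipsoid U S c' \<rho>"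
      using s by (auto simp: sandwich_def)
    note \<rho> = sandwich_ratio[OF U False s]
    then have \<rho>0: "\<rho> > 0" by simp
    obtain T where T: "linear_automorphism_on U T" "\<And>y. y \<in> U \<Longrightarrow> norm (S (T y)) = norm y"
      using injective_map_isometry[OF U S] by metis
    have lT: "linear T" and TU: "T ` U = U" and Ti: "inj_on T U"
      using T(1) by (auto simp: linear_automorphism_on_def bij_betw_def)
    \<comment> \<open>The two ellipsoids are homothetic with ratio \<open>\<rho>\<close>, and the dilation centre has to be moved to the
        origin. The vector \<open>a\<close> is the position of the outer centre relative to the dilation centre; for
        \<open>\<rho> = 1\<close> the centres coincide and \<open>a = 0\<close> works.\<close>
    define a where "a = (if c = c' then 0 else (c - c') /\<^sub>R (1 / \<rho> - 1))"
    have a: "c - c' = a /\<^sub>R \<rho> - a" "a \<in> U"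
    proof -
      have "c - c' = (1 / \<rho> - 1) *\<^sub>R a"
        using \<rho> by (auto simp: a_def)
      then show "c - c' = a /\<^sub>R \<rho> - a" by (simp add: algebra_simps divide_inverse)
      show "a \<in> U" using U c by (auto simp: a_def subspace_0 subspace_scale subspace_diff)
    qed
    let ?T = "\<lambda>x. \<rho> *\<^sub>R T x"
    have "a /\<^sub>R \<rho> \<in> T ` U" using U a by (simp add: TU subspace_scale)
    then obtain v where v: "v \<in> U" "a /\<^sub>R \<rho> = T v" by blast
    then have "?T v = \<rho> *\<^sub>R (a /\<^sub>R \<rho>)" by simp
    with v(1) have v: "v \<in> U" "a = ?T v" using \<rho>0 by simp_all
    define u where "u = a - c'"
    have u: "u \<in> U" using U a c by (simp add: u_def subspace_diff)
    have "inj_on ?T U" using Ti \<rho>0 by (auto simp: inj_on_def)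
    moreover have "?T ` U = U"
    proof -
      have "(*\<^sub>R) \<rho> ` U = U"
      proof
        show "U \<subseteq> (*\<^sub>R) \<rho> ` U"
        proof
          fix x assume "x \<in> U"
          then have "x /\<^sub>R \<rho> \<in> U" "x = \<rho> *\<^sub>R (x /\<^sub>R \<rho>)" using \<rho>0 U by (auto simp: subspace_scale)
          then show "x \<in> (*\<^sub>R) \<rho> ` U" by blast
        qed
      qed (use U in \<open>auto simp: subspace_scale\<close>)
      then show ?thesis by (simp only: TU flip: image_image[of _ T])
    qed
    moreover have "linear ?T" using lT by (rule linear_compose_scale_right)
    ultimately have "linear_automorphism_on U ?T" by (simp add: linear_automorphism_on_def bij_betw_def)
    moreover have "(+) u ` K \<subseteq> ?T ` ((+) v ` (cball 0 1 \<inter> U))"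
    proof (intro subsetI, elim imageE)
      fix z x assume z: "z = u + x" and x: "x \<in> K"
      have xe: "x \<in> U" "norm (S (x - c')) \<le> \<rho>" using x out by (auto simp: ellipsoid_def)
      then have "x - c' \<in> T ` U" using U c by (simp add: TU subspace_diff)
      then obtain y where y: "y \<in> U" "x - c' = T y" by blast
      have "norm (y /\<^sub>R \<rho>) \<le> 1" using xe T(2)[OF y(1)] y(2) \<rho>0 by (simp add: field_simps)
      moreover have "z = ?T (v + y /\<^sub>R \<rho>)"
        using v(2) y(2) \<rho>0
        by (simp add: z u_def linear_add[OF lT] linear_scale[OF lT] algebra_simps)
      moreover have "y /\<^sub>R \<rho> \<in> U" using y U by (simp add: subspace_scale)
      ultimately show "z \<in> ?T ` ((+) v ` (cball 0 1 \<inter> U))"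
        by (intro image_eqI[of _ _ "v + y /\<^sub>R \<rho>"] image_eqI[of _ _ "y /\<^sub>R \<rho>"]) auto
    qed
    moreover have "?T ` ((+) v ` (cball 0 1 \<inter> U)) \<subseteq> (*\<^sub>R) \<rho> ` ((+) u ` K)"
    proof (intro subsetI, elim imageE)
      fix z w y assume z: "z = \<rho> *\<^sub>R T w" and w: "w = v + y" and y: "y \<in> cball 0 1 \<inter> U"
      have "c + T y \<in> ellipsoid U S c 1"
        using y c imageI[of y U T] U T(2)[of y] by (simp add: ellipsoid_def subspace_add TU)
      then have "c + T y \<in> K" using inn by blast
      moreover have "z = \<rho> *\<^sub>R (u + (c + T y))"
      proof -
        have "\<rho> *\<^sub>R (c - c') = a - \<rho> *\<^sub>R a" unfolding a(1) using \<rho>0 by (simp add: algebra_simps)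
        then show ?thesis unfolding z w linear_add[OF lT] scaleR_add_right v(2)[symmetric] u_def
          by (simp add: algebra_simps)
      qed
      ultimately show "z \<in> (*\<^sub>R) \<rho> ` ((+) u ` K)" by blast
    qed
    ultimately show ?L using u v(1) less_imp_le[OF \<rho>0] by (intro conjI exI[of _ ?T] bexI[of _ u] bexI[of _ v])
  qed
  then show ?thesis by (simp add: banach_mazur_dist_def)
qed

lemma banach_mazur_dist_le:
  assumes "subspace U" "sandwich U K S c c' \<rho>"
  shows "banach_mazur_dist U K (cball 0 1 \<inter> U) \<le> \<rho>"
proof -
  have "K \<noteq> {}" using sandwich_center[OF assms(2)] by blast
  moreover have "bdd_below {\<rho>. \<exists>S c c'. sandwich U K S c c' \<rho>}"
    by (rule bdd_belowI[of _ 0]) (auto dest: sandwich_nonneg)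
  ultimately show ?thesis
    using assms by (auto simp: banach_mazur_dist_ball intro!: cInf_lower)
qed

lemma sandwich_below:
  assumes "subspace U" "sandwich U K S c c' \<rho>" "banach_mazur_dist U K (cball 0 1 \<inter> U) < \<delta>"
  obtains S' k k' \<rho>' where "sandwich U K S' k k' \<rho>'" "\<rho>' < \<delta>"
proof -
  have "K \<noteq> {}" using sandwich_center[OF assms(2)] by blast
  then have "Inf {\<rho>. \<exists>S c c'. sandwich U K S c c' \<rho>} < \<delta>"
    using assms by (simp add: banach_mazur_dist_ball)
  then obtain \<rho>' where "\<rho>' \<in> {\<rho>. \<exists>S c c'. sandwich U K S c c' \<rho>}" "\<rho>' < \<delta>"
    using cInf_lessD[of "{\<rho>. \<exists>S c c'. sandwich U K S c c' \<rho>}" \<delta>] assms(2) by blast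
  then show thesis using that by blast
qed

lemma distance_ellipsoids_iff:
  fixes K :: "'a::euclidean_space set"
  assumes U: "subspace U" and d: "d = banach_mazur_dist U K (cball 0 1 \<inter> U)" "0 < d"
  shows "distance_ellipsoids U K (E, F) \<longleftrightarrow>
    (\<exists>S c c'. sandwich U K S c c' d \<and> E = ellipsoid U S c 1 \<and> F = ellipsoid U S c' d)"
proof
  assume "distance_ellipsoids U K (E, F)"
  then obtain t where E: "ellipsoid_in U E" and F: "ellipsoid_in U F" "F = (+) t ` (*\<^sub>R) d ` E"
    and sub: "E \<subseteq> K" "K \<subseteq> F" by (auto simp: distance_ellipsoids_def d)
  obtain S c where S: "linear S" "inj_on S U" "c \<in> U" and ES: "E = ellipsoid U S c 1"
    using E by (auto simp: ellipsoid_in_iff[OF U])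
  have "F \<subseteq> U" using F(1) by (auto simp: ellipsoid_in_iff[OF U] ellipsoid_def)
  moreover have "c \<in> E" using S by (simp add: ES ellipsoid_def linear_0)
  ultimately have c': "t + d *\<^sub>R c \<in> U" using F(2) by blast
  have "(t + d *\<^sub>R c) - d *\<^sub>R c \<in> U"
    using c' S(3) U by (intro subspace_diff subspace_scale)
  then have t: "t \<in> U" by simp
  have *: "norm (S (d *\<^sub>R e - d *\<^sub>R c)) = d * norm (S (e - c))" for e
    using d by (simp add: linear_scale[OF S(1)] linear_diff[OF S(1)] flip: scaleR_diff_right)
  have "F = ellipsoid U S (t + d *\<^sub>R c) d"
  proof (intro set_eqI iffI)
    fix x assume "x \<in> F"
    then obtain e where e: "e \<in> E" "x = t + d *\<^sub>R e" using F by blast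
    then show "x \<in> ellipsoid U S (t + d *\<^sub>R c) d"
      using \<open>x \<in> F\<close> \<open>F \<subseteq> U\<close> * d by (auto simp: ES ellipsoid_def)
  next
    fix x assume x: "x \<in> ellipsoid U S (t + d *\<^sub>R c) d"
    define e where "e = (x - t) /\<^sub>R d"
    have e: "x = t + d *\<^sub>R e" using d by (simp add: e_def)
    have "e \<in> U" using x t U by (simp add: e_def ellipsoid_def subspace_diff subspace_scale)
    moreover have "norm (S (e - c)) \<le> 1" using x * d unfolding e by (simp add: ellipsoid_def)
    ultimately show "x \<in> F" unfolding F(2) e ES ellipsoid_def by blast
  qed
  then show "\<exists>S c c'. sandwich U K S c c' d \<and> E = ellipsoid U S c 1 \<and> F = ellipsoid U S c' d"
    using S c' sub ES unfolding sandwich_def by blast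
next
  assume "\<exists>S c c'. sandwich U K S c c' d \<and> E = ellipsoid U S c 1 \<and> F = ellipsoid U S c' d"
  then obtain S c c' where s: "sandwich U K S c c' d" and E: "E = ellipsoid U S c 1"
    and F: "F = ellipsoid U S c' d" by blast
  have S: "linear S" "inj_on S U" and c: "c \<in> U" "c' \<in> U"
    and inn: "ellipsoid U S c 1 \<subseteq> K" and out: "K \<subseteq> ellipsoid U S c' d"
    using s by (auto simp: sandwich_def)
  have "F = ellipsoid U (\<lambda>x. S x /\<^sub>R d) c' 1"
    using d by (auto simp: F ellipsoid_def field_simps)
  moreover have "linear (\<lambda>x. S x /\<^sub>R d)" using S(1) by (rule linear_compose_scale_right)
  moreover have "inj_on (\<lambda>x. S x /\<^sub>R d) U" using S(2) d by (auto simp: inj_on_def)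
  ultimately have "ellipsoid_in U F" using c unfolding ellipsoid_in_iff[OF U] by blast
  moreover have "ellipsoid_in U E" using S c E unfolding ellipsoid_in_iff[OF U] by blast
  moreover have "F = (+) (c' - d *\<^sub>R c) ` (*\<^sub>R) d ` E"
  proof (intro set_eqI iffI)
    fix x assume x: "x \<in> F"
    define e where "e = c + (x - c') /\<^sub>R d"
    have "e - c = (x - c') /\<^sub>R d" by (simp add: e_def)
    then have "norm (S (e - c)) = norm (S (x - c')) / d"
      using d by (simp add: linear_scale[OF S(1)] divide_inverse mult.commute)
    then have "norm (S (e - c)) \<le> 1"
      using x d by (simp add: F ellipsoid_def)
    moreover have "e \<in> U"
      using x c U by (simp add: e_def F ellipsoid_def subspace_diff subspace_scale subspace_add)
    moreover have "x = (c' - d *\<^sub>R c) + d *\<^sub>R e" using d by (simp add: e_def algebra_simps)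
    ultimately show "x \<in> (+) (c' - d *\<^sub>R c) ` (*\<^sub>R) d ` E" by (auto simp: E ellipsoid_def)
  next
    fix x assume "x \<in> (+) (c' - d *\<^sub>R c) ` (*\<^sub>R) d ` E"
    then obtain e where e: "e \<in> U" "norm (S (e - c)) \<le> 1" "x = (c' - d *\<^sub>R c) + d *\<^sub>R e"
      by (auto simp: E ellipsoid_def)
    have "x - c' = d *\<^sub>R (e - c)" by (simp add: e algebra_simps)
    then have "norm (S (x - c')) \<le> d" using e d by (simp add: linear_scale[OF S(1)])
    then show "x \<in> F" using e c U by (simp add: F ellipsoid_def subspace_diff subspace_scale subspace_add)
  qed
  ultimately show "distance_ellipsoids U K (E, F)"
    using inn out E F by (auto simp: distance_ellipsoids_def d(1)[symmetric])
qed

section \<open>Existence of distance ellipsoids\<close>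

lemma norm_rescaled_diff_le_iff:
  fixes x y :: "'a::real_normed_vector"
  assumes "0 < r"
  shows "norm ((x - y) /\<^sub>R r) \<le> t \<longleftrightarrow> dist y x \<le> t * r"
proof -
  have "norm ((x - y) /\<^sub>R r) = dist y x / r"
    using assms by (simp add: dist_norm norm_minus_commute divide_inverse mult.commute)
  then show ?thesis using assms by (simp add: pos_divide_le_eq)
qed

lemma sandwich_of_balls:
  fixes K :: "'a::euclidean_space set"
  assumes "cball z s \<subseteq> K" "K \<subseteq> cball z M" "0 < s"
  shows "sandwich UNIV K (\<lambda>x. x /\<^sub>R s) z z (M / s)"
proof -
  have "linear (\<lambda>x::'a. x /\<^sub>R s)" by (rule linear_scale_self)
  moreover have "inj (\<lambda>x::'a. x /\<^sub>R s)" using assms(3) by (auto simp: inj_on_def)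
  ultimately show ?thesis
    using assms unfolding sandwich_def ellipsoid_def
    by (auto simp: subset_iff norm_rescaled_diff_le_iff simp del: norm_scaleR)
qed

text \<open>The inner ellipsoid is contained in a bounded body, which bounds the gauge from below. Together with
\<open>sandwich_upper_bound\<close> this confines the gauges of all sandwiches of bounded ratio to a compact set of
injective maps.\<close>

lemma sandwich_lower_bound:
  assumes s: "sandwich UNIV K S c c' \<rho>" and R: "\<And>x. x \<in> K \<Longrightarrow> norm x \<le> R"
  shows "norm y \<le> 2 * R * norm (S y)"
proof (cases "y = 0")
  case False
  have S: "linear S" "inj S" and inn: "ellipsoid UNIV S c 1 \<subseteq> K" using s by (auto simp: sandwich_def)
  have Sy: "0 < norm (S y)" using False S by (metis injD linear_0 zero_less_norm_iff)
  have "c + y /\<^sub>R norm (S y) \<in> K"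
    using inn Sy by (auto simp: ellipsoid_def subset_iff linear_scale[OF S(1)])
  from R[OF this] R[OF sandwich_center[OF s]]
  have "norm (c + y /\<^sub>R norm (S y) - c) \<le> 2 * R" by (smt (verit) norm_triangle_ineq4)
  then show ?thesis using Sy by (simp add: field_simps)
qed (use s in \<open>auto simp: sandwich_def linear_0\<close>)

text \<open>A ball inside the body lies in the outer ellipsoid, which bounds the gauge from above.\<close>

lemma sandwich_upper_bound:
  assumes s: "sandwich UNIV K S c c' \<rho>" and z: "cball z e \<subseteq> K" "0 < e"
  shows "norm (S y) \<le> \<rho> / e * norm y"
proof (cases "y = 0")
  case False
  have S: "linear S" and out: "K \<subseteq> ellipsoid UNIV S c' \<rho>" using s by (auto simp: sandwich_def)
  define w where "w = (e / norm y) *\<^sub>R y"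
  have "norm w = e" using False z by (simp add: w_def)
  then have "z + w \<in> K" "z - w \<in> K" using z by (auto simp: subset_iff dist_norm)
  then have "norm (S (z + w - c')) \<le> \<rho>" "norm (S (z - w - c')) \<le> \<rho>" using out by (auto simp: ellipsoid_def)
  moreover have "2 *\<^sub>R S w = S (z + w - c') - S (z - w - c')"
    by (simp add: linear_add[OF S] linear_diff[OF S] scaleR_2)
  then have "2 * norm (S w) = norm (S (z + w - c') - S (z - w - c'))"
    by (metis norm_scaleR abs_numeral)
  ultimately have "2 * norm (S w) \<le> 2 * \<rho>" by (smt (verit) norm_triangle_ineq4)
  moreover have "norm (S w) = e / norm y * norm (S y)" using z by (simp add: w_def linear_scale[OF S])
  ultimately show ?thesis using False z by (simp add: field_simps)
qed (use s in \<open>auto simp: sandwich_def linear_0\<close>)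

text \<open>The infimum in the definition of the distance is attained: gauges and centres of a minimizing sequence
stay bounded, and a limit of sandwiches is a sandwich, whose gauge is injective by the lower bound.\<close>

lemma optimal_sandwich_exists:
  fixes K :: "'a::euclidean_space set"
  defines "d \<equiv> banach_mazur_dist UNIV K (cball 0 1)"
  assumes K: "convex_body K"
  shows "\<exists>S c c'. sandwich UNIV K S c c' d"
proof -
  have cK: "closed K" and bK: "bounded K" and iK: "interior K \<noteq> {}"
    using K by (auto simp: convex_body_def compact_eq_bounded_closed)
  obtain z e where z: "cball z e \<subseteq> K" "0 < e" using iK by (auto simp: mem_interior_cball)
  obtain M where M: "K \<subseteq> cball z M" using bK by (auto simp: bounded_any_center[of _ z] subset_iff)
  obtain R where R: "\<And>x. x \<in> K \<Longrightarrow> norm x \<le> R" using bK by (auto simp: bounded_iff)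
  note s0 = sandwich_of_balls[OF z(1) M z(2)]
  have dle: "d \<le> \<rho>" if "sandwich UNIV K S c c' \<rho>" for S c c' \<rho>
    using banach_mazur_dist_le[OF subspace_UNIV that] by (simp add: d_def)
  have "\<exists>S c c' \<rho>. sandwich UNIV K S c c' \<rho> \<and> \<rho> < d + 1 / real (Suc n)" for n
    using sandwich_below[OF subspace_UNIV s0, of "d + 1 / real (Suc n)"] by (simp add: d_def) metis
  then obtain S c c' \<rho> where s: "\<And>n. sandwich UNIV K (S n) (c n) (c' n) (\<rho> n)"
    and \<rho>: "\<And>n. \<rho> n < d + 1 / real (Suc n)" by metis
  have \<rho>1: "\<rho> n \<le> d + 1" for n
  proof -
    have "1 / real (Suc n) \<le> 1" by simp
    then show ?thesis using \<rho>[of n] by linarith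
  qed
  have S: "linear (S n)" and inn: "ellipsoid UNIV (S n) (c n) 1 \<subseteq> K"
    and out: "K \<subseteq> ellipsoid UNIV (S n) (c' n) (\<rho> n)" for n
    using s[of n] by (auto simp: sandwich_def)
  define A where "A n = Blinfun (S n)" for n
  have A: "blinfun_apply (A n) = S n" for n
    unfolding A_def using S by (simp add: bounded_linear_Blinfun_apply linear_conv_bounded_linear[symmetric])
  have \<rho>0: "0 \<le> \<rho> n" for n using sandwich_nonneg[OF s] .
  have R0: "0 \<le> R" using R[OF sandwich_center[OF s]] norm_ge_zero order_trans by blast
  have An: "norm (A n) \<le> (d + 1) / e" for n
  proof (rule norm_blinfun_bound)
    show "0 \<le> (d + 1) / e" using \<rho>0[of n] \<rho>1[of n] z by simp
    fix y
    have "norm (S n y) \<le> \<rho> n / e * norm y" by (rule sandwich_upper_bound[OF s z])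
    also have "\<dots> \<le> (d + 1) / e * norm y" using \<rho>1 z by (intro mult_right_mono divide_right_mono) auto
    finally show "norm (A n y) \<le> (d + 1) / e * norm y" by (simp add: A)
  qed
  have cn: "norm (c n) \<le> R" for n using R sandwich_center[OF s] by blast
  have c'n: "norm (c' n) \<le> 2 * R * (d + 1) + R" for n
  proof -
    have "norm (c n - c' n) \<le> 2 * R * norm (S n (c n - c' n))"
      by (rule sandwich_lower_bound[OF s R])
    also have "norm (S n (c n - c' n)) \<le> \<rho> n"
      using out sandwich_center[OF s] by (auto simp: ellipsoid_def)
    also have "\<rho> n \<le> d + 1" by (rule \<rho>1)
    finally have "norm (c n - c' n) \<le> 2 * R * (d + 1)" using R0 by (simp add: mult_left_mono)
    then show ?thesis using cn[of n] norm_triangle_ineq4[of "c n" "c n - c' n"] by simp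
  qed
  have "bounded (range (\<lambda>n. (A n, c n, c' n)))"
  proof (rule bounded_subset)
    show "bounded (cball 0 ((d + 1) / e) \<times> cball 0 R \<times> cball (0 :: 'a) (2 * R * (d + 1) + R) ::
        (('a \<Rightarrow>\<^sub>L 'a) \<times> 'a \<times> 'a) set)"
      by (intro bounded_Times bounded_cball)
  qed (use An cn c'n in auto)
  then obtain l \<phi> where \<phi>: "strict_mono \<phi>" and lim: "((\<lambda>n. (A n, c n, c' n)) \<circ> \<phi>) \<longlonglongrightarrow> l"
    using bounded_imp_convergent_subsequence by blast
  obtain T k k' where l: "l = (T, k, k')" by (cases l)
  have limA: "(\<lambda>n. A (\<phi> n)) \<longlonglongrightarrow> T" and limc: "(\<lambda>n. c (\<phi> n)) \<longlonglongrightarrow> k"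
    and limc': "(\<lambda>n. c' (\<phi> n)) \<longlonglongrightarrow> k'"
    using tendsto_fst[OF lim] tendsto_fst[OF tendsto_snd[OF lim]] tendsto_snd[OF tendsto_snd[OF lim]]
    by (simp_all add: l o_def)
  have "(\<lambda>n. d + 1 / real (Suc n)) \<longlonglongrightarrow> d + 0"
    by (intro tendsto_intros LIMSEQ_Suc lim_1_over_n)
  then have "\<rho> \<longlonglongrightarrow> d"
    using \<rho> dle[OF s]
    by (intro tendsto_sandwich[of "\<lambda>n. d" \<rho> _ "\<lambda>n. d + 1 / real (Suc n)"] always_eventually allI)
      (auto intro: less_imp_le simp del: of_nat_Suc)
  then have lim\<rho>: "(\<lambda>n. \<rho> (\<phi> n)) \<longlonglongrightarrow> d" using LIMSEQ_subseq_LIMSEQ[OF _ \<phi>] by (simp add: o_def)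

  have lower: "norm y \<le> 2 * R * norm (T y)" for y
  proof (rule LIMSEQ_le_const)
    show "(\<lambda>n. 2 * R * norm (A (\<phi> n) y)) \<longlonglongrightarrow> 2 * R * norm (T y)"
      by (intro tendsto_intros blinfun.tendsto limA)
    show "\<exists>N. \<forall>n\<ge>N. norm y \<le> 2 * R * norm (A (\<phi> n) y)"
      using sandwich_lower_bound[OF s R] by (auto simp: A)
  qed
  have linT: "linear (blinfun_apply T)"
    by (simp add: blinfun.bounded_linear_right linear_conv_bounded_linear)
  have "inj (blinfun_apply T)"
    unfolding linear_injective_0[OF linT]
  proof (intro allI impI)
    fix x assume "blinfun_apply T x = 0"
    then show "x = 0" using lower[of x] by simp
  qed
  moreover have "K \<subseteq> ellipsoid UNIV (blinfun_apply T) k' d"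
  proof
    fix x assume x: "x \<in> K"
    have "(\<lambda>n. norm (A (\<phi> n) (x - c' (\<phi> n)))) \<longlonglongrightarrow> norm (T (x - k'))"
      by (intro tendsto_intros blinfun.tendsto limA limc')
    moreover have "norm (A (\<phi> n) (x - c' (\<phi> n))) \<le> \<rho> (\<phi> n)" for n
      using x out[of "\<phi> n"] by (auto simp: A ellipsoid_def)
    ultimately have "norm (T (x - k')) \<le> d" using lim\<rho> by (intro LIMSEQ_le) auto
    then show "x \<in> ellipsoid UNIV (blinfun_apply T) k' d" by (simp add: ellipsoid_def)
  qed
  moreover have "ellipsoid UNIV (blinfun_apply T) k 1 \<subseteq> K"
  proof
    fix x assume "x \<in> ellipsoid UNIV (blinfun_apply T) k 1"
    then have x: "norm (T (x - k)) \<le> 1" by (simp add: ellipsoid_def)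
    \<comment> \<open>Shrink the vector \<open>x - k\<close> just enough to fit into the \<open>n\<close>-th inner ellipsoid.\<close>
    define q where "q n = max 1 (norm (A (\<phi> n) (x - k)))" for n
    have "q \<longlonglongrightarrow> max 1 (norm (T (x - k)))"
      unfolding q_def by (intro tendsto_intros blinfun.tendsto limA)
    then have "q \<longlonglongrightarrow> 1" using x by simp
    then have "(\<lambda>n. c (\<phi> n) + (x - k) /\<^sub>R q n) \<longlonglongrightarrow> k + (x - k) /\<^sub>R 1"
      by (intro tendsto_intros limc) auto
    then have lim_x: "(\<lambda>n. c (\<phi> n) + (x - k) /\<^sub>R q n) \<longlonglongrightarrow> x" by simp
    have "c (\<phi> n) + (x - k) /\<^sub>R q n \<in> K" for n
    proof -
      have "0 < q n" "norm (S (\<phi> n) (x - k)) \<le> q n" by (auto simp: q_def A)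
      then have "norm (S (\<phi> n) ((x - k) /\<^sub>R q n)) \<le> 1"
        unfolding linear_scale[OF S] by (simp add: field_simps)
      then show ?thesis using inn[of "\<phi> n"] by (auto simp: ellipsoid_def)
    qed
    then show "x \<in> K" using lim_x by (rule closed_sequentially[OF cK])
  qed
  ultimately have "sandwich UNIV K (blinfun_apply T) k k' d"
    unfolding sandwich_def using linT by simp
  then show ?thesis by blast
qed

section \<open>Affine images\<close>

lemma sandwich_affine_image:
  fixes D :: "'a::euclidean_space \<Rightarrow> 'a" and a :: 'a
  defines "A \<equiv> \<lambda>x. D x + a"
  assumes U: "subspace U" and D: "linear D" "inj_on D U" "D ` U = U'" and a: "a \<in> U'"
    and s: "sandwich U K S c c' \<rho>"
  obtains S' where "sandwich U' (A ` K) S' (A c) (A c') \<rho>"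
    "ellipsoid U' S' (A c) 1 = A ` ellipsoid U S c 1"
    "ellipsoid U' S' (A c') \<rho> = A ` ellipsoid U S c' \<rho>"
proof -
  have S: "linear S" "inj_on S U" and c: "c \<in> U" "c' \<in> U"
    and sub: "ellipsoid U S c 1 \<subseteq> K" "K \<subseteq> ellipsoid U S c' \<rho>"
    using s by (auto simp: sandwich_def)
  have U': "subspace U'" using linear_subspace_image[OF D(1) U] D(3) by simp
  obtain G where G: "range G \<subseteq> U" "linear G" "\<And>x. x \<in> U \<Longrightarrow> G (D x) = x"
    using linear_inj_on_left_inverse[of D U] U D by (metis span_eq_iff)
  have GU: "G y \<in> U" for y using G(1) by blast
  have DU: "D x \<in> U'" if "x \<in> U" for x using D(3) that by blast
  have "inj_on G U'" unfolding D(3)[symmetric] by (rule inj_on_inverseI[of _ D]) (use G(3) in auto)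
  then have inj: "inj_on (S \<circ> G) U'"
    by (rule comp_inj_on) (use S(2) GU in \<open>meson image_subsetI inj_on_subset\<close>)
  have ell: "ellipsoid U' (S \<circ> G) (A e) r = A ` ellipsoid U S e r" if e: "e \<in> U" for e r
  proof (intro set_eqI iffI)
    fix y assume y: "y \<in> ellipsoid U' (S \<circ> G) (A e) r"
    then have "y - a \<in> D ` U" using U' a by (simp add: ellipsoid_def D(3) subspace_diff)
    then obtain x where x: "x \<in> U" "y - a = D x" by blast
    have "y - A e = D (x - e)"
      unfolding linear_diff[OF D(1)] x(2)[symmetric] by (simp add: A_def algebra_simps)
    then have "G (y - A e) = x - e" using G(3) subspace_diff[OF U x(1) e] by simp
    then have "x \<in> ellipsoid U S e r" using y x by (simp add: ellipsoid_def)
    moreover have "y = A x" using x(2) by (simp add: A_def algebra_simps)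
    ultimately show "y \<in> A ` ellipsoid U S e r" by blast
  next
    fix y assume "y \<in> A ` ellipsoid U S e r"
    then obtain x where x: "x \<in> U" "norm (S (x - e)) \<le> r" "y = A x" by (auto simp: ellipsoid_def)
    have "y - A e = D (x - e)" by (simp add: x A_def linear_diff[OF D(1)])
    then have "G (y - A e) = x - e" using G(3) subspace_diff[OF U x(1) e] by simp
    moreover have "y \<in> U'" using DU[OF x(1)] a U' by (simp add: x(3) A_def subspace_add)
    ultimately show "y \<in> ellipsoid U' (S \<circ> G) (A e) r" using x by (simp add: ellipsoid_def)
  qed
  have "linear (S \<circ> G)" using G(2) S(1) by (rule linear_compose)
  moreover have "A c \<in> U'" "A c' \<in> U'" using c DU a U' by (auto simp: A_def subspace_add)
  ultimately have "sandwich U' (A ` K) (S \<circ> G) (A c) (A c') \<rho>"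
    unfolding sandwich_def ell[OF c(1)] ell[OF c(2)] using inj sub by (intro conjI image_mono)
  then show ?thesis using ell c by (intro that) auto
qed

lemma sandwich_linear_image:
  fixes T :: "'a::euclidean_space \<Rightarrow> 'a"
  assumes U: "subspace U" and T: "linear T" "inj T" and s: "sandwich U K S c c' \<rho>"
  obtains S' where "sandwich (T ` U) (T ` K) S' (T c) (T c') \<rho>"
    "ellipsoid (T ` U) S' (T c) 1 = T ` ellipsoid U S c 1"
    "ellipsoid (T ` U) S' (T c') \<rho> = T ` ellipsoid U S c' \<rho>"
proof -
  have "0 \<in> T ` U" using linear_subspace_image[OF T(1) U] by (rule subspace_0)
  then show thesis
    using sandwich_affine_image[OF U T(1) inj_on_subset[OF T(2)] refl _ s, of 0] that by auto
qed

text \<open>Distances and distance ellipsoids are carried along by a linear isomorphism, although the ball of the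
subspace need not be mapped to the ball of the image: only the class of ellipsoids matters.\<close>

context
  fixes T T' :: "'a::euclidean_space \<Rightarrow> 'a" and U :: "'a set"
  assumes T: "linear T" "linear T'" "\<And>x. T' (T x) = x" "\<And>x. T (T' x) = x" and U: "subspace U"
begin

lemma linear_iso_inj: "inj T" "inj T'"
  using T(3,4) by (auto intro: inj_on_inverseI)

lemma linear_iso_image: "T' ` T ` A = A" "T ` T' ` A = A"
  by (simp_all add: image_image T)

lemma banach_mazur_dist_linear_image:
  assumes "K \<noteq> {}"
  shows "banach_mazur_dist (T ` U) (T ` K) (cball 0 1 \<inter> T ` U) = banach_mazur_dist U K (cball 0 1 \<inter> U)"
proof -
  have U': "subspace (T ` U)" using linear_subspace_image[OF T(1) U] .
  have "(\<exists>S c c'. sandwich (T ` U) (T ` K) S c c' \<rho>) \<longleftrightarrow> (\<exists>S c c'. sandwich U K S c c' \<rho>)" for \<rho>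
  proof (intro iffI; elim exE)
    fix S c c' assume "sandwich U K S c c' \<rho>"
    then obtain S' where "sandwich (T ` U) (T ` K) S' (T c) (T c') \<rho>"
      by (rule sandwich_linear_image[OF U T(1) linear_iso_inj(1)])
    then show "\<exists>S c c'. sandwich (T ` U) (T ` K) S c c' \<rho>" by blast
  next
    fix S c c' assume "sandwich (T ` U) (T ` K) S c c' \<rho>"
    then obtain S' where "sandwich (T' ` T ` U) (T' ` T ` K) S' (T' c) (T' c') \<rho>"
      by (rule sandwich_linear_image[OF U' T(2) linear_iso_inj(2)])
    then show "\<exists>S c c'. sandwich U K S c c' \<rho>" unfolding linear_iso_image by blast
  qed
  then show ?thesis using assms U U' by (simp add: banach_mazur_dist_ball)
qed

lemma distance_ellipsoids_linear_image:
  assumes pos: "0 < banach_mazur_dist U K (cball 0 1 \<inter> U)" and K: "K \<noteq> {}"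
    and E: "distance_ellipsoids U K (E, F)"
  shows "distance_ellipsoids (T ` U) (T ` K) (T ` E, T ` F)"
proof -
  let ?d = "banach_mazur_dist U K (cball 0 1 \<inter> U)"
  obtain S c c' where s: "sandwich U K S c c' ?d" and EF: "E = ellipsoid U S c 1" "F = ellipsoid U S c' ?d"
    using distance_ellipsoids_iff[OF U refl pos, THEN iffD1, OF E] by blast
  obtain S' where s': "sandwich (T ` U) (T ` K) S' (T c) (T c') ?d"
    and EF': "ellipsoid (T ` U) S' (T c) 1 = T ` E" "ellipsoid (T ` U) S' (T c') ?d = T ` F"
    unfolding EF by (rule sandwich_linear_image[OF U T(1) linear_iso_inj(1) s])
  show ?thesis
    unfolding distance_ellipsoids_iff[OF linear_subspace_image[OF T(1) U]
        banach_mazur_dist_linear_image[OF K, symmetric] pos]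
    by (intro exI conjI) (rule s', simp_all only: EF')
qed

end

lemma unique_distance_ellipsoids_linear_image:
  fixes T T' :: "'a::euclidean_space \<Rightarrow> 'a"
  assumes T: "linear T" "linear T'" "\<And>x. T' (T x) = x" "\<And>x. T (T' x) = x" and U: "subspace U"
    and pos: "0 < banach_mazur_dist U K (cball 0 1 \<inter> U)" and K: "K \<noteq> {}"
    and ex1: "\<exists>!P. distance_ellipsoids U K P"
  shows "\<exists>!P. distance_ellipsoids (T ` U) (T ` K) P"
proof -
  have U': "subspace (T ` U)" using linear_subspace_image[OF T(1) U] .
  note img = linear_iso_image[OF T U]
  obtain E F where EF: "distance_ellipsoids U K (E, F)"
    and uniq: "\<And>P. distance_ellipsoids U K P \<Longrightarrow> P = (E, F)" using ex1 by (metis surj_pair)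
  show ?thesis
  proof (rule ex1I)
    show "distance_ellipsoids (T ` U) (T ` K) (T ` E, T ` F)"
      by (rule distance_ellipsoids_linear_image[OF T U pos K EF])
    fix P assume P: "distance_ellipsoids (T ` U) (T ` K) P"
    obtain E' F' where EF': "P = (E', F')" by (cases P)
    have "distance_ellipsoids (T' ` T ` U) (T' ` T ` K) (T' ` E', T' ` F')"
      using P pos K
      by (intro distance_ellipsoids_linear_image[OF T(2,1,4,3) U'])
        (simp_all add: EF' banach_mazur_dist_linear_image[OF T U])
    then have "(T' ` E', T' ` F') = (E, F)" unfolding img by (rule uniq)
    then have "E = T' ` E'" "F = T' ` F'" by simp_all
    then show "P = (T ` E, T ` F)" by (simp add: EF' img)
  qed
qed

section \<open>Averaging two optimal pairs\<close>

lemma weighted_squares_complete: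
  fixes \<alpha> \<beta> :: real
  assumes "0 < \<alpha>" "0 < \<beta>"
  shows "\<alpha> * (s - p)\<^sup>2 + \<beta> * (s - q)\<^sup>2 =
    (\<alpha> + \<beta>) * (s - (\<alpha> * p + \<beta> * q) / (\<alpha> + \<beta>))\<^sup>2 + \<alpha> * \<beta> / (\<alpha> + \<beta>) * (p - q)\<^sup>2"
proof -
  have "\<alpha> + \<beta> \<noteq> 0" using assms by simp
  then show ?thesis by (simp add: power2_eq_square divide_simps) algebra
qed

lemma harmonic_le_quadratic_mean:
  fixes a b :: real
  assumes "0 < a" "0 < b"
  shows "1 / ((1 / a + 1 / b) / 2) \<le> sqrt ((a\<^sup>2 + b\<^sup>2) / 2)"
    "a \<noteq> b \<Longrightarrow> 1 / ((1 / a + 1 / b) / 2) < sqrt ((a\<^sup>2 + b\<^sup>2) / 2)"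
proof -
  have "0 \<le> (a - b)\<^sup>2" by simp
  then have "((a + b) / 2)\<^sup>2 \<le> (a\<^sup>2 + b\<^sup>2) / 2" by (simp add: power2_eq_square algebra_simps)
  then have 1: "(a + b) / 2 \<le> sqrt ((a\<^sup>2 + b\<^sup>2) / 2)" by (rule real_le_rsqrt)
  have eq: "1 / ((1 / a + 1 / b) / 2) = (a + b) / 2 - (a - b)\<^sup>2 / (2 * (a + b))"
    using assms by (simp add: divide_simps power2_eq_square) algebra
  have "0 \<le> (a - b)\<^sup>2 / (2 * (a + b))" using assms by simp
  then show "1 / ((1 / a + 1 / b) / 2) \<le> sqrt ((a\<^sup>2 + b\<^sup>2) / 2)" using 1 unfolding eq by linarith
  assume "a \<noteq> b"
  then have "0 < (a - b)\<^sup>2 / (2 * (a + b))" using assms by simp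
  then show "1 / ((1 / a + 1 / b) / 2) < sqrt ((a\<^sup>2 + b\<^sup>2) / 2)" using 1 unfolding eq by linarith
qed

text \<open>Two different optimal pairs can be averaged to a pair whose outer semi-axes, divided by \<open>\<rho>\<close>, are at most
the inner ones and strictly smaller in some direction \<open>v\<close>. Here \<open>f\<close> and \<open>g\<close> are the
inverse semi-axes of the inner and the outer gauge.\<close>

lemma strict_sandwich_of_two_sandwiches:
  fixes K U :: "'a::euclidean_space set"
  assumes U: "subspace U" and K: "convex K" and r: "0 < r"
    and s1: "sandwich U K (\<lambda>x. x /\<^sub>R r) c1 c1' \<rho>" and s2: "sandwich U K S c2 c2' \<rho>"
    and min: "\<And>S c c' \<rho>'. sandwich U K S c c' \<rho>' \<Longrightarrow> \<rho> \<le> \<rho>'"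
    and neq: "\<not> (ellipsoid U S c2 1 = ellipsoid U (\<lambda>x. x /\<^sub>R r) c1 1 \<and>
                ellipsoid U S c2' \<rho> = ellipsoid U (\<lambda>x. x /\<^sub>R r) c1' \<rho>)"
  obtains B v f g c c' where "orthonormal_basis B U" "v \<in> B" "\<And>b. b \<in> B \<Longrightarrow> 0 < (f b :: real)"
    "\<And>b. b \<in> B \<Longrightarrow> f b \<le> g b" "f v < g v" "c \<in> U" "c' \<in> U"
    "ellipsoid U (diag B f) c 1 \<subseteq> K" "K \<subseteq> ellipsoid U (diag B g) c' \<rho>"
proof -
  have c1: "c1 \<in> U" "c1' \<in> U" and in1: "ellipsoid U (\<lambda>x. x /\<^sub>R r) c1 1 \<subseteq> K"
    and out1: "K \<subseteq> ellipsoid U (\<lambda>x. x /\<^sub>R r) c1' \<rho>" using s1 by (auto simp: sandwich_def)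
  have S: "linear S" "inj_on S U" and c2: "c2 \<in> U" "c2' \<in> U" and in2: "ellipsoid U S c2 1 \<subseteq> K"
    and out2: "K \<subseteq> ellipsoid U S c2' \<rho>" using s2 by (auto simp: sandwich_def)
  have KU: "K \<subseteq> U" using out1 by (auto simp: ellipsoid_def)
  note \<rho> = sandwich_nonneg[OF s1]
  obtain B h where B: "orthonormal_basis B U" and h: "\<And>b. b \<in> B \<Longrightarrow> 0 < (h b :: real)"
    and Sh: "\<And>x. x \<in> U \<Longrightarrow> norm (S x) = norm (diag B h x)"
    using diagonalization[OF U S] by metis
  \<comment> \<open>Semi-axes: \<open>r\<close> for the ball and \<open>1 / h b\<close> for the second ellipsoid. The inner average has the
      arithmetic means as semi-axes, the outer average has the mean of the quadratic forms.\<close>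
  define f where "f b = 1 / ((1 / (1 / r) + 1 / h b) / 2)" for b
  define g where "g b = sqrt (((1 / r)\<^sup>2 + (h b)\<^sup>2) / 2)" for b
  have f: "0 < f b" if "b \<in> B" for b
    using h[OF that] r by (auto simp: f_def intro!: add_pos_pos)
  have fg: "f b \<le> g b" "1 / r \<noteq> h b \<Longrightarrow> f b < g b" if "b \<in> B" for b
    using harmonic_le_quadratic_mean[of "1 / r" "h b"] h[OF that] r
    unfolding f_def g_def by simp_all
  have g2: "(g b)\<^sup>2 = (1 / r)\<^sup>2 / 2 + (h b)\<^sup>2 / 2" for b
    by (simp add: g_def add_divide_distrib)
  define c where "c = (1 / 2) *\<^sub>R c1 + (1 / 2) *\<^sub>R c2"
  have c: "c \<in> U" using c1 c2 U by (simp add: c_def subspace_add subspace_scale)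

  have inner: "ellipsoid U (diag B f) c 1 \<subseteq> K"
  proof
    fix x assume x: "x \<in> ellipsoid U (diag B f) c 1"
    define y where "y = diag B f (x - c)"
    have y: "y \<in> U" "norm y \<le> 1" using x by (auto simp: y_def diag_mem[OF B] ellipsoid_def)
    have yb: "f b * (x \<bullet> b - c \<bullet> b) = y \<bullet> b" if "b \<in> B" for b
      by (simp add: y_def diag_inner[OF B that] inner_diff_left)
    let ?x1 = "c1 + r *\<^sub>R y" and ?x2 = "c2 + diag B (\<lambda>b. 1 / h b) y"
    have "?x1 \<in> ellipsoid U (\<lambda>x. x /\<^sub>R r) c1 1"
      using y c1 U r by (simp add: ellipsoid_def subspace_add subspace_scale flip: mult.assoc)
    then have "?x1 \<in> K" using in1 by blast
    moreover have "?x2 \<in> ellipsoid U S c2 1"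
      using y c2 U diag_mem[OF B] diag_inverse(1)[OF B _ y(1), of h] h
      by (force simp: ellipsoid_def subspace_add Sh)
    then have "?x2 \<in> K" using in2 by blast
    ultimately have "(1 / 2) *\<^sub>R ?x1 + (1 / 2) *\<^sub>R ?x2 \<in> K" using K by (intro convexD) auto
    moreover have "x = (1 / 2) *\<^sub>R ?x1 + (1 / 2) *\<^sub>R ?x2"
    proof (rule orthonormal_basis_eqI[OF B])
      show "x \<in> U" using x by (simp add: ellipsoid_def)
      show "(1 / 2) *\<^sub>R ?x1 + (1 / 2) *\<^sub>R ?x2 \<in> U"
        using y c1 c2 U diag_mem[OF B] by (simp add: subspace_add subspace_scale)
      fix b assume b: "b \<in> B"
      have "x \<bullet> b = c \<bullet> b + (r + 1 / h b) / 2 * (y \<bullet> b)"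
      proof -
        have "0 < r + 1 / h b" using h[OF b] r by (intro add_pos_pos) auto
        then have "f b * ((r + 1 / h b) / 2) = 1" by (simp add: f_def)
        then have "(r + 1 / h b) / 2 * (y \<bullet> b) = x \<bullet> b - c \<bullet> b"
          unfolding yb[OF b, symmetric] by (simp add: mult.assoc[symmetric] mult.commute)
        then show ?thesis by linarith
      qed
      then show "x \<bullet> b = ((1 / 2) *\<^sub>R ?x1 + (1 / 2) *\<^sub>R ?x2) \<bullet> b"
        by (simp add: c_def inner_add_left diag_inner[OF B b] add_divide_distrib algebra_simps)
    qed
    ultimately show "x \<in> K" by simp
  qed

  define \<alpha> where "\<alpha> = (1 / r)\<^sup>2 / 2"
  define \<beta> where "\<beta> b = (h b)\<^sup>2 / 2" for b
  have \<alpha>: "0 < \<alpha>" using r by (simp add: \<alpha>_def)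
  have \<beta>: "0 < \<beta> b" if "b \<in> B" for b using h[OF that] by (simp add: \<beta>_def)
  have g2': "(g b)\<^sup>2 = \<alpha> + \<beta> b" for b by (simp add: g2 \<alpha>_def \<beta>_def)
  define m where "m = (\<Sum>b\<in>B. ((\<alpha> * (c1' \<bullet> b) + \<beta> b * (c2' \<bullet> b)) / (\<alpha> + \<beta> b)) *\<^sub>R b)"
  have m: "m \<in> U" "\<And>b. b \<in> B \<Longrightarrow> m \<bullet> b = (\<alpha> * (c1' \<bullet> b) + \<beta> b * (c2' \<bullet> b)) / (\<alpha> + \<beta> b)"
    unfolding m_def using coordinates_mem[OF B] coordinates_inner[OF B] by auto
  define gain where "gain = (\<Sum>b\<in>B. \<alpha> * \<beta> b / (\<alpha> + \<beta> b) * (c1' \<bullet> b - c2' \<bullet> b)\<^sup>2)"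
  have outer: "(norm (diag B g (x - m)))\<^sup>2 + gain \<le> \<rho>\<^sup>2" if x: "x \<in> K" for x
  proof -
    have xU: "x \<in> U" using x KU by blast
    have "norm ((x - c1') /\<^sub>R r) \<le> \<rho>" using x out1 by (auto simp: ellipsoid_def)
    then have "(norm ((x - c1') /\<^sub>R r))\<^sup>2 \<le> \<rho>\<^sup>2" by (intro power_mono) auto
    moreover have "(norm ((x - c1') /\<^sub>R r))\<^sup>2 = (1 / r)\<^sup>2 * (norm (x - c1'))\<^sup>2"
      using r by (simp add: power_mult_distrib divide_inverse)
    moreover have "(norm (x - c1'))\<^sup>2 = (\<Sum>b\<in>B. (x \<bullet> b - c1' \<bullet> b)\<^sup>2)"
      using norm_orthonormal_basis[OF B subspace_diff[OF U xU c1(2)]] by (simp add: inner_diff_left)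
    moreover have "(\<Sum>b\<in>B. \<alpha> * (x \<bullet> b - c1' \<bullet> b)\<^sup>2)
        = (1 / r)\<^sup>2 * (\<Sum>b\<in>B. (x \<bullet> b - c1' \<bullet> b)\<^sup>2) / 2"
      unfolding \<alpha>_def sum_distrib_left[symmetric] by simp
    ultimately have 1: "(\<Sum>b\<in>B. \<alpha> * (x \<bullet> b - c1' \<bullet> b)\<^sup>2) \<le> \<rho>\<^sup>2 / 2" by simp
    have "norm (S (x - c2')) \<le> \<rho>" using x out2 by (auto simp: ellipsoid_def)
    then have "(norm (S (x - c2')))\<^sup>2 \<le> \<rho>\<^sup>2" by (intro power_mono) auto
    then have "(\<Sum>b\<in>B. (h b)\<^sup>2 * (x \<bullet> b - c2' \<bullet> b)\<^sup>2) / 2 \<le> \<rho>\<^sup>2 / 2"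
      by (simp add: Sh[OF subspace_diff[OF U xU c2(2)]] norm_diag[OF B] inner_diff_left power_mult_distrib)
    then have 2: "(\<Sum>b\<in>B. \<beta> b * (x \<bullet> b - c2' \<bullet> b)\<^sup>2) \<le> \<rho>\<^sup>2 / 2"
      by (simp add: \<beta>_def sum_divide_distrib)
    have "(norm (diag B g (x - m)))\<^sup>2 + gain =
        (\<Sum>b\<in>B. \<alpha> * (x \<bullet> b - c1' \<bullet> b)\<^sup>2 + \<beta> b * (x \<bullet> b - c2' \<bullet> b)\<^sup>2)"
      unfolding norm_diag[OF B] gain_def sum.distrib[symmetric]
      by (intro sum.cong refl)
        (simp add: weighted_squares_complete[OF \<alpha> \<beta>] power_mult_distrib g2' inner_diff_left m(2))
    then show ?thesis using 1 2 by (simp add: sum.distrib)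
  qed

  \<comment> \<open>Completing the square leaves the constant \<open>gain\<close>, which is positive unless the outer centres agree;
      a positive gain would beat the optimal ratio.\<close>
  have cc: "c1' = c2'"
  proof (rule ccontr)
    assume ne: "c1' \<noteq> c2'"
    then obtain b0 where b0: "b0 \<in> B" "c1' \<bullet> b0 \<noteq> c2' \<bullet> b0"
      using orthonormal_basis_eqI[OF B c1(2) c2(2)] by blast
    have "0 < gain" unfolding gain_def
    proof (rule sum_pos2[OF orthonormal_basis_finite[OF B] b0(1)])
      show "0 < \<alpha> * \<beta> b0 / (\<alpha> + \<beta> b0) * (c1' \<bullet> b0 - c2' \<bullet> b0)\<^sup>2"
        using \<alpha> \<beta>[OF b0(1)] b0(2) by simp
      show "0 \<le> \<alpha> * \<beta> b / (\<alpha> + \<beta> b) * (c1' \<bullet> b - c2' \<bullet> b)\<^sup>2" if "b \<in> B" for b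
        using \<alpha> \<beta>[OF that] by simp
    qed
    have "K \<subseteq> ellipsoid U (diag B f) m (sqrt (\<rho>\<^sup>2 - gain))"
    proof
      fix x assume x: "x \<in> K"
      have "(norm (diag B f (x - m)))\<^sup>2 \<le> (norm (diag B g (x - m)))\<^sup>2"
        unfolding norm_diag[OF B] power_mult_distrib
        using f fg by (intro sum_mono mult_right_mono power_mono) (auto intro: less_imp_le)
      then have "(norm (diag B f (x - m)))\<^sup>2 \<le> \<rho>\<^sup>2 - gain" using outer[OF x] by linarith
      then show "x \<in> ellipsoid U (diag B f) m (sqrt (\<rho>\<^sup>2 - gain))"
        using x KU by (auto simp: ellipsoid_def intro: real_le_rsqrt)
    qed
    then have "sandwich U K (diag B f) c m (sqrt (\<rho>\<^sup>2 - gain))"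
      unfolding sandwich_def using inner c m(1)
      by (intro conjI linear_diag inj_on_diag[OF B]) (auto dest: f)
    then have "\<rho> \<le> sqrt (\<rho>\<^sup>2 - gain)" by (rule min)
    also have "\<dots> < sqrt (\<rho>\<^sup>2)" using \<open>0 < gain\<close> by (intro real_sqrt_less_mono) simp
    finally show False using \<rho> by simp
  qed
  have mc: "m = c1'"
  proof (rule orthonormal_basis_eqI[OF B m(1) c1(2)])
    fix b assume b: "b \<in> B"
    then show "m \<bullet> b = c1' \<bullet> b" using \<alpha> \<beta>[OF b] by (simp add: m(2) cc flip: distrib_right)
  qed
  have out: "K \<subseteq> ellipsoid U (diag B g) c1' \<rho>"
  proof
    fix x assume x: "x \<in> K"
    have "0 \<le> gain" unfolding gain_def using \<alpha> \<beta> by (intro sum_nonneg) (simp add: less_imp_le)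
    then have "(norm (diag B g (x - c1')))\<^sup>2 \<le> \<rho>\<^sup>2" using outer[OF x] mc by simp
    then show "x \<in> ellipsoid U (diag B g) c1' \<rho>"
      using x KU \<rho> by (auto simp: ellipsoid_def intro: power2_le_imp_le)
  qed
  show thesis
  proof (cases "\<exists>v\<in>B. 1 / r \<noteq> h v")
    case True
    then obtain v where "v \<in> B" "1 / r \<noteq> h v" by blast
    then show thesis using that[OF B, of v f g c c1'] f fg c c1 inner out by blast
  next
    case False
    \<comment> \<open>Both pairs consist of balls of the same radii with a common outer centre, so the inner centres
        differ. The convex hull of the two inner balls contains an ellipsoid that is longer by
        \<open>d / 2\<close> in the direction of the segment between the centres.\<close>
    have "norm (S x) = norm (x /\<^sub>R r)" if "x \<in> U" for x
    proof -
      have "diag B h x = x /\<^sub>R r"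
        using that U False
        by (intro orthonormal_basis_eqI[OF B])
          (auto simp: diag_mem[OF B] diag_inner[OF B] subspace_scale divide_inverse)
      then show ?thesis using Sh[OF that] by simp
    qed
    then have ell: "ellipsoid U S e s = ellipsoid U (\<lambda>x. x /\<^sub>R r) e s" if "e \<in> U" for e s
      using that subspace_diff[OF U] by (auto simp: ellipsoid_def)
    then have ne: "c1 \<noteq> c2" using neq c2 cc by auto
    define d where "d = norm (c1 - c2)"
    define v where "v = (c1 - c2) /\<^sub>R d"
    have d: "0 < d" using ne by (simp add: d_def)
    have v: "v \<in> U" "norm v = 1"
      using c1 c2 U d by (auto simp: v_def d_def subspace_scale subspace_diff)
    have dv: "c1 - c2 = d *\<^sub>R v" using d by (simp add: v_def)
    obtain B0 where B0: "orthonormal_basis B0 {x \<in> U. x \<bullet> v = 0}"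
      using singular_basis[OF dim_hyperplane_section_less(1)[OF U v] linear_id] by blast
    define B' where "B' = insert v B0"
    note B' = orthonormal_basis_insert(1)[OF U v B0, folded B'_def]
    have vB: "v \<in> B'" by (simp add: B'_def)
    define f' where "f' b = (if b = v then 1 / (r + d / 2) else 1 / r)" for b
    have "ellipsoid U (diag B' f') c 1 \<subseteq> K"
    proof
      fix x assume x: "x \<in> ellipsoid U (diag B' f') c 1"
      define y where "y = diag B' f' (x - c)"
      have y: "y \<in> U" "norm y \<le> 1" using x by (auto simp: y_def diag_mem[OF B'] ellipsoid_def)
      have yb: "f' b * (x \<bullet> b - c \<bullet> b) = y \<bullet> b" if "b \<in> B'" for b
        by (simp add: y_def diag_inner[OF B' that] inner_diff_left)
      have "\<bar>y \<bullet> v\<bar> \<le> norm y * norm v" by (rule Cauchy_Schwarz_ineq2)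
      then have Y: "\<bar>y \<bullet> v\<bar> \<le> 1" using y v by simp
      have "c1 + r *\<^sub>R y \<in> K" using y c1 U r in1
        by (auto simp: ellipsoid_def subset_iff subspace_add subspace_scale simp flip: mult.assoc)
      moreover have "c2 + r *\<^sub>R y \<in> ellipsoid U S c2 1" unfolding ell[OF c2(1)]
        using y c2 U r by (simp add: ellipsoid_def subspace_add subspace_scale flip: mult.assoc)
      then have "c2 + r *\<^sub>R y \<in> K" using in2 by blast
      ultimately have "((1 + y \<bullet> v) / 2) *\<^sub>R (c1 + r *\<^sub>R y) + ((1 - y \<bullet> v) / 2) *\<^sub>R (c2 + r *\<^sub>R y) \<in> K"
        using K Y by (intro convexD) (auto simp: field_simps)
      also have "((1 + y \<bullet> v) / 2) *\<^sub>R (c1 + r *\<^sub>R y) + ((1 - y \<bullet> v) / 2) *\<^sub>R (c2 + r *\<^sub>R y) =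
          c + r *\<^sub>R y + ((y \<bullet> v) / 2) *\<^sub>R (c1 - c2)"
        by (simp add: c_def add_divide_distrib diff_divide_distrib algebra_simps, simp flip: scaleR_add_left)
      also have "\<dots> = x"
      proof (rule orthonormal_basis_eqI[OF B'])
        show "x \<in> U" using x by (simp add: ellipsoid_def)
        show "c + r *\<^sub>R y + ((y \<bullet> v) / 2) *\<^sub>R (c1 - c2) \<in> U"
          using c c1 c2 y U by (simp add: subspace_add subspace_scale subspace_diff)
        fix b assume b: "b \<in> B'"
        show "(c + r *\<^sub>R y + ((y \<bullet> v) / 2) *\<^sub>R (c1 - c2)) \<bullet> b = x \<bullet> b"
        proof (cases "b = v")
          case True
          have "(r + d / 2) * (y \<bullet> v) = x \<bullet> v - c \<bullet> v"
            using yb[OF vB] r d by (simp add: f'_def field_simps)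
          then show ?thesis unfolding dv True
            using orthonormal_basis_inner[OF B' vB vB] by (simp add: inner_add_left algebra_simps)
        next
          case False
          then have "r * (y \<bullet> b) = x \<bullet> b - c \<bullet> b"
            using yb[OF b] r by (simp add: f'_def field_simps)
          then show ?thesis unfolding dv
            using orthonormal_basis_inner[OF B' vB b] False by (simp add: inner_add_left)
        qed
      qed
      finally show "x \<in> K" .
    qed
    moreover have "K \<subseteq> ellipsoid U (diag B' (\<lambda>b. 1 / r)) c1' \<rho>"
    proof -
      have "diag B' (\<lambda>b. 1 / r) x = x /\<^sub>R r" if "x \<in> U" for x
        using that U by (intro orthonormal_basis_eqI[OF B'])
          (auto simp: diag_mem[OF B'] diag_inner[OF B'] subspace_scale divide_inverse)
      then have "ellipsoid U (\<lambda>x. x /\<^sub>R r) c1' \<rho> = ellipsoid U (diag B' (\<lambda>b. 1 / r)) c1' \<rho>"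
        using subspace_diff[OF U _ c1(2)] by (auto simp: ellipsoid_def)
      then show ?thesis using out1 by simp
    qed
    moreover have "0 < f' b" "f' b \<le> 1 / r" for b
      using r d by (auto simp: f'_def intro!: divide_left_mono add_pos_pos)
    moreover have "f' v < 1 / r"
      using r d by (auto simp: f'_def intro!: divide_strict_left_mono mult_pos_pos add_pos_pos)
    ultimately show thesis using that[OF B' vB, of f' "\<lambda>b. 1 / r" c c1'] c c1 by blast
  qed
qed

section \<open>Perturbation along a direction of strict slack\<close>

text \<open>Interpolation between a unit semi-axis and a semi-axis \<open>1 / f\<close>: the inverse square of the averaged semi-axis
is at most the average of the inverse squares, and a factor \<open>\<kappa> > 1\<close> on the second outer form becomes a
relative gain of first order in \<open>\<epsilon>\<close>.\<close>

lemma weighted_mean_harmonic_bound: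
  fixes \<epsilon> f \<gamma> \<kappa> :: real
  assumes \<epsilon>: "0 \<le> \<epsilon>" "\<epsilon> \<le> 1 / 2" and f: "0 < f" and \<gamma>: "4 * \<gamma> \<le> (\<kappa> - 1) * f\<^sup>2" and \<kappa>: "1 \<le> \<kappa>"
  shows "(1 + \<epsilon> * \<gamma>) / ((1 - \<epsilon>) + \<epsilon> / f)\<^sup>2 \<le> (1 - \<epsilon>) + \<epsilon> * \<kappa> * f\<^sup>2"
proof -
  let ?t = "(1 - \<epsilon>) + \<epsilon> / f"
  have t: "1 / 2 \<le> ?t" using \<epsilon> f by (smt (verit) divide_nonneg_pos field_sum_of_halves)
  \<comment> \<open>Cauchy--Schwarz for the weights \<open>1 - \<epsilon>\<close> and \<open>\<epsilon>\<close>, followed by convexity of the square.\<close>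
  have "1 \<le> ?t * ((1 - \<epsilon>) + \<epsilon> * f)"
  proof -
    have "0 \<le> \<epsilon> * (1 - \<epsilon>) * ((f - 1)\<^sup>2 / f)" using \<epsilon> f by simp
    also have "\<dots> = ?t * ((1 - \<epsilon>) + \<epsilon> * f) - 1"
      using f by (simp add: field_simps power2_eq_square)
    finally show ?thesis by simp
  qed
  then have "1\<^sup>2 \<le> (?t * ((1 - \<epsilon>) + \<epsilon> * f))\<^sup>2" by (intro power_mono) auto
  also have "\<dots> = ?t\<^sup>2 * ((1 - \<epsilon>) + \<epsilon> * f)\<^sup>2" by (simp only: power_mult_distrib)
  also have "\<dots> \<le> ?t\<^sup>2 * ((1 - \<epsilon>) + \<epsilon> * f\<^sup>2)"
  proof (rule mult_left_mono)
    have "0 \<le> \<epsilon> * (1 - \<epsilon>) * (f - 1)\<^sup>2" using \<epsilon> by simp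
    also have "\<dots> = ((1 - \<epsilon>) + \<epsilon> * f\<^sup>2) - ((1 - \<epsilon>) + \<epsilon> * f)\<^sup>2"
      by (simp add: algebra_simps power2_eq_square)
    finally show "((1 - \<epsilon>) + \<epsilon> * f)\<^sup>2 \<le> (1 - \<epsilon>) + \<epsilon> * f\<^sup>2" by simp
  qed simp
  finally have 1: "1 \<le> ?t\<^sup>2 * ((1 - \<epsilon>) + \<epsilon> * f\<^sup>2)" by simp
  have t2: "1 / 4 \<le> ?t\<^sup>2" using power_mono[OF t, of 2] by (simp add: power2_eq_square)
  have "\<epsilon> * \<gamma> \<le> \<epsilon> * (1 / 4 * ((\<kappa> - 1) * f\<^sup>2))" using \<gamma> \<epsilon> by (intro mult_left_mono) auto
  also have "\<dots> \<le> \<epsilon> * (?t\<^sup>2 * ((\<kappa> - 1) * f\<^sup>2))"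
    using t2 \<epsilon> \<kappa> by (intro mult_left_mono mult_right_mono) auto
  finally have "1 + \<epsilon> * \<gamma> \<le> ?t\<^sup>2 * ((1 - \<epsilon>) + \<epsilon> * f\<^sup>2) + \<epsilon> * (?t\<^sup>2 * ((\<kappa> - 1) * f\<^sup>2))" using 1 by linarith
  also have "\<dots> = ((1 - \<epsilon>) + \<epsilon> * \<kappa> * f\<^sup>2) * ?t\<^sup>2" by algebra
  finally have "1 + \<epsilon> * \<gamma> \<le> ((1 - \<epsilon>) + \<epsilon> * \<kappa> * f\<^sup>2) * ?t\<^sup>2" .
  moreover have "0 < ?t\<^sup>2" using t2 by linarith
  ultimately show ?thesis by (simp only: pos_divide_le_eq)
qed

text \<open>Points of the inner ellipsoid are moved along \<open>v\<close> by an uncontrolled amount \<open>\<epsilon> * s\<close> with \<open>\<bar>s\<bar> \<le> R\<close>. Close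
to the equator \<open>Y = 0\<close> the slack \<open>\<sigma> < 1\<close> alone cannot absorb a shift of first order in \<open>\<epsilon>\<close>, but the unit
sphere is tangent to \<open>v\<close> there, so shrinking everything by \<open>1 - M * \<epsilon>\<^sup>2\<close> suffices.\<close>

lemma tilt_bound:
  fixes \<epsilon> \<sigma> R s P Y q :: real
  defines "M \<equiv> R\<^sup>2 / (\<sigma> * (1 - \<sigma>))"
  assumes \<sigma>: "0 < \<sigma>" "\<sigma> < 1" and \<epsilon>: "\<sigma> \<le> (1 - \<epsilon>)\<^sup>2" "M * \<epsilon>\<^sup>2 \<le> 1" and s: "\<bar>s\<bar> \<le> R"
    and P: "P + Y\<^sup>2 \<le> (1 - M * \<epsilon>\<^sup>2)\<^sup>2"
  shows "(\<sigma> * Y - \<epsilon> * s)\<^sup>2 \<le> (1 - \<epsilon>)\<^sup>2 * (1 - P)"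
proof -
  have M: "0 \<le> M" using \<sigma> by (simp add: M_def)
  \<comment> \<open>Write the tilted coordinate as a convex combination with weights \<open>\<sigma>\<close> and \<open>1 - \<sigma>\<close>.\<close>
  define z where "z = - \<epsilon> * s / (1 - \<sigma>)"
  have "(\<sigma> * Y - \<epsilon> * s)\<^sup>2 = (\<sigma> * Y + (1 - \<sigma>) * z)\<^sup>2" using \<sigma> by (simp add: z_def)
  also have "\<dots> \<le> \<sigma> * Y\<^sup>2 + (1 - \<sigma>) * z\<^sup>2"
  proof -
    have "0 \<le> \<sigma> * (1 - \<sigma>) * (Y - z)\<^sup>2" using \<sigma> by simp
    also have "\<dots> = \<sigma> * Y\<^sup>2 + (1 - \<sigma>) * z\<^sup>2 - (\<sigma> * Y + (1 - \<sigma>) * z)\<^sup>2"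
      by (simp add: algebra_simps power2_eq_square)
    finally show ?thesis by simp
  qed
  also have "(1 - \<sigma>) * z\<^sup>2 = s\<^sup>2 * (\<epsilon>\<^sup>2 / (1 - \<sigma>))"
  proof -
    have "u * (- \<epsilon> * s / u)\<^sup>2 = s\<^sup>2 * (\<epsilon>\<^sup>2 / u)" if "u \<noteq> 0" for u
      using that by (simp add: power2_eq_square)
    then show ?thesis unfolding z_def using \<sigma> by simp
  qed
  also have "\<dots> \<le> R\<^sup>2 * (\<epsilon>\<^sup>2 / (1 - \<sigma>))"
    using \<sigma> s by (intro mult_right_mono) (auto simp: abs_le_square_iff[symmetric])
  also have "\<dots> = \<sigma> * (M * \<epsilon>\<^sup>2)" using \<sigma> by (simp add: M_def field_simps)
  finally have "(\<sigma> * Y - \<epsilon> * s)\<^sup>2 \<le> \<sigma> * (Y\<^sup>2 + M * \<epsilon>\<^sup>2)" by (simp add: algebra_simps)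
  also have "\<dots> \<le> \<sigma> * (1 - P)"
  proof (rule mult_left_mono)
    have "0 \<le> (M * \<epsilon>\<^sup>2) * (1 - M * \<epsilon>\<^sup>2)" using \<epsilon> M by simp
    moreover have "(1 - M * \<epsilon>\<^sup>2)\<^sup>2 = 1 - M * \<epsilon>\<^sup>2 - (M * \<epsilon>\<^sup>2) * (1 - M * \<epsilon>\<^sup>2)"
      by (simp add: algebra_simps power2_eq_square)
    ultimately show "Y\<^sup>2 + M * \<epsilon>\<^sup>2 \<le> 1 - P" using P by linarith
  qed (use \<sigma> in simp)
  also have "\<dots> \<le> (1 - \<epsilon>)\<^sup>2 * (1 - P)"
  proof (rule mult_right_mono[OF \<epsilon>(1)])
    have "(1 - M * \<epsilon>\<^sup>2)\<^sup>2 \<le> 1" using \<epsilon> M by (intro power_le_one) auto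
    then show "0 \<le> 1 - P" using P by (smt (verit) zero_le_power2)
  qed
  finally show ?thesis .
qed

text \<open>The gain \<open>\<epsilon> * \<gamma>\<close> is of first order and the loss \<open>M * \<epsilon>\<^sup>2\<close> of second order, so the gain wins for small
\<open>\<epsilon>\<close>, while the slack in the direction \<open>v\<close> still tolerates both.\<close>

lemma small_parameter:
  fixes \<sigma> \<eta> \<gamma> M :: real
  assumes "\<sigma> < 1" "1 < (1 + \<eta>) * \<sigma>\<^sup>2" "0 < \<gamma>"  "0 \<le> M"
  obtains \<epsilon> where "0 < \<epsilon>" "\<epsilon> \<le> 1 / 2" "\<sigma> \<le> (1 - \<epsilon>)\<^sup>2" "M * \<epsilon>\<^sup>2 < 1"
    "1 + \<epsilon> * \<gamma> \<le> (1 - \<epsilon>) * ((1 + \<eta>) * \<sigma>\<^sup>2)" "1 < (1 - M * \<epsilon>\<^sup>2)\<^sup>2 * (1 + \<epsilon> * \<gamma>)"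
proof -
  let ?F = "at_right (0 :: real)"
  have "((\<lambda>\<epsilon>. (1 - \<epsilon>)\<^sup>2) \<longlongrightarrow> (1 - 0)\<^sup>2) ?F" by (intro tendsto_intros)
  then have 1: "\<forall>\<^sub>F \<epsilon> in ?F. \<sigma> < (1 - \<epsilon>)\<^sup>2" using assms(1) by (intro order_tendstoD(1)) auto
  have "((\<lambda>\<epsilon>. M * \<epsilon>\<^sup>2) \<longlongrightarrow> M * 0\<^sup>2) ?F" by (intro tendsto_intros)
  then have 2: "\<forall>\<^sub>F \<epsilon> in ?F. M * \<epsilon>\<^sup>2 < 1" by (intro order_tendstoD(2)) auto
  have "((\<lambda>\<epsilon>. (1 - \<epsilon>) * ((1 + \<eta>) * \<sigma>\<^sup>2) - (1 + \<epsilon> * \<gamma>)) \<longlongrightarrow> (1 - 0) * ((1 + \<eta>) * \<sigma>\<^sup>2) - (1 + 0 * \<gamma>)) ?F"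
    by (intro tendsto_intros)
  then have 3: "\<forall>\<^sub>F \<epsilon> in ?F. 0 < (1 - \<epsilon>) * ((1 + \<eta>) * \<sigma>\<^sup>2) - (1 + \<epsilon> * \<gamma>)"
    using assms(2) by (intro order_tendstoD(1)) auto
  have "((\<lambda>\<epsilon>. 2 * M * \<epsilon> * (1 + \<epsilon> * \<gamma>)) \<longlongrightarrow> 2 * M * 0 * (1 + 0 * \<gamma>)) ?F" by (intro tendsto_intros)
  then have 4: "\<forall>\<^sub>F \<epsilon> in ?F. 2 * M * \<epsilon> * (1 + \<epsilon> * \<gamma>) < \<gamma>"
    using assms(3) by (intro order_tendstoD(2)) auto
  have 5: "\<forall>\<^sub>F \<epsilon> in ?F. 0 < \<epsilon> \<and> \<epsilon> < 1 / 2"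
    by (auto simp: eventually_at_right[of 0 1] intro!: exI[of _ "1/2"])
  have "\<forall>\<^sub>F \<epsilon> in ?F. (0 < \<epsilon> \<and> \<epsilon> < 1 / 2) \<and> \<sigma> < (1 - \<epsilon>)\<^sup>2 \<and> M * \<epsilon>\<^sup>2 < 1 \<and>
      0 < (1 - \<epsilon>) * ((1 + \<eta>) * \<sigma>\<^sup>2) - (1 + \<epsilon> * \<gamma>) \<and> 2 * M * \<epsilon> * (1 + \<epsilon> * \<gamma>) < \<gamma>"
    by (intro eventually_conj 1 2 3 4 5)
  then obtain \<epsilon> where e: "0 < \<epsilon>" "\<epsilon> < 1 / 2" "\<sigma> < (1 - \<epsilon>)\<^sup>2" "M * \<epsilon>\<^sup>2 < 1"
      "0 < (1 - \<epsilon>) * ((1 + \<eta>) * \<sigma>\<^sup>2) - (1 + \<epsilon> * \<gamma>)" "2 * M * \<epsilon> * (1 + \<epsilon> * \<gamma>) < \<gamma>"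
    using eventually_happens'[OF trivial_limit_at_right_real] by blast
  have "0 < \<epsilon> * (\<gamma> - 2 * M * \<epsilon> * (1 + \<epsilon> * \<gamma>))" using e by simp
  then have "1 < (1 - 2 * (M * \<epsilon>\<^sup>2)) * (1 + \<epsilon> * \<gamma>)" by (simp add: algebra_simps power2_eq_square)
  also have "\<dots> \<le> (1 - M * \<epsilon>\<^sup>2)\<^sup>2 * (1 + \<epsilon> * \<gamma>)"
  proof (rule mult_right_mono)
    have "(1 - M * \<epsilon>\<^sup>2)\<^sup>2 = 1 - 2 * (M * \<epsilon>\<^sup>2) + (M * \<epsilon>\<^sup>2)\<^sup>2" by (simp add: power2_diff)
    then show "1 - 2 * (M * \<epsilon>\<^sup>2) \<le> (1 - M * \<epsilon>\<^sup>2)\<^sup>2" by simp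
  qed (use e assms in simp)
  finally show thesis using e by (intro that[of \<epsilon>]) auto
qed

text \<open>The given pair of ratio \<open>\<rho>\<close> has strict slack in the direction \<open>v\<close>: the outer form exceeds the inner one by
\<open>\<eta>\<close> there. If the projection of the body along \<open>v\<close> admits a pair of ratio less than \<open>\<rho>\<close>, then so does the
body itself: mix the given pair with a small portion \<open>\<epsilon>\<close> of the
better pair in the hyperplane. The inner ellipsoid of the hyperplane lies in the projection of \<open>K\<close> rather
than in \<open>K\<close>, so its points have to be lifted; the slack allows to shrink the inner semi-axis along \<open>v\<close> to
\<open>\<sigma> < 1\<close>, and by \<open>tilt_bound\<close> the lifting then costs only a factor \<open>1 - M * \<epsilon>\<^sup>2\<close>.\<close>

lemma better_ratio_from_hyperplane_normalized:
  fixes K U :: "'a::euclidean_space set" and v :: 'a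
  defines "W \<equiv> {x \<in> U. x \<bullet> v = 0}"
  assumes U: "subspace U" and K: "convex K" "bounded K" "K \<subseteq> U" and v: "v \<in> U" "norm v = 1"
    and inner: "\<And>x. x \<in> U \<Longrightarrow> norm x \<le> 1 \<Longrightarrow> x \<in> K"
    and \<eta>: "0 < \<eta>" and c': "c' \<in> U"
    and outer: "\<And>x. x \<in> K \<Longrightarrow> (norm (x - c'))\<^sup>2 + \<eta> * ((x - c') \<bullet> v)\<^sup>2 \<le> \<rho>\<^sup>2"
    and \<rho>: "0 < \<rho>'" "\<rho>' < \<rho>"
    and s: "sandwich W ((\<lambda>x. x - (x \<bullet> v) *\<^sub>R v) ` K) S k k' \<rho>'"
  shows "\<exists>S c c' \<rho>''. \<rho>'' < \<rho> \<and> sandwich U K S c c' \<rho>''"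
proof -
  note W = dim_hyperplane_section_less(1)[OF U v, folded W_def]
  have S: "linear S" "inj_on S W" and k: "k \<in> W" "k' \<in> W"
    and Sin: "ellipsoid W S k 1 \<subseteq> (\<lambda>x. x - (x \<bullet> v) *\<^sub>R v) ` K"
    and Sout: "(\<lambda>x. x - (x \<bullet> v) *\<^sub>R v) ` K \<subseteq> ellipsoid W S k' \<rho>'"
    using s by (auto simp: sandwich_def)
  obtain B0 f where B0: "orthonormal_basis B0 W" and f: "\<And>b. b \<in> B0 \<Longrightarrow> 0 < (f b :: real)"
    and Sf: "\<And>x. x \<in> W \<Longrightarrow> norm (S x) = norm (diag B0 f x)"
    using diagonalization[OF W S] by metis
  define B where "B = insert v B0"
  have B: "orthonormal_basis B U" and vB: "v \<notin> B0"
    using orthonormal_basis_insert[OF U v] B0 unfolding W_def B_def by auto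
  have fin: "finite B0" by (rule orthonormal_basis_finite[OF B0])
  have vv: "v \<bullet> v = 1" using v by (simp add: dot_square_norm)
  have bv: "b \<bullet> v = 0" "v \<bullet> b = 0" if "b \<in> B0" for b
    using orthonormal_basis_mem[OF B0 that] by (auto simp: W_def inner_commute)
  have sumB: "(\<Sum>b\<in>B. h b) = h v + (\<Sum>b\<in>B0. h b)" for h :: "'a \<Rightarrow> real"
    unfolding B_def using fin vB by simp
  obtain R where R: "\<And>x. x \<in> K \<Longrightarrow> norm x \<le> R" using K(2) by (auto simp: bounded_iff)

  \<comment> \<open>The relative gain \<open>\<gamma>\<close> per unit of \<open>\<epsilon>\<close>: \<open>m\<close> bounds the inverse semi-axes from below, and the factor
      \<open>1/4\<close> leaves room for \<open>\<epsilon> \<le> 1/2\<close>.\<close>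
  define m where "m = Min (insert 1 (f ` B0))"
  have m: "0 < m" "\<And>b. b \<in> B0 \<Longrightarrow> m \<le> f b" using f fin by (auto simp: m_def)
  define \<kappa> where "\<kappa> = (\<rho> / \<rho>')\<^sup>2"
  have "1 < \<rho> / \<rho>'" using \<rho> by simp
  then have \<kappa>: "1 < \<kappa>" unfolding \<kappa>_def by (intro one_less_power) auto
  define \<gamma> where "\<gamma> = (\<kappa> - 1) * m\<^sup>2 / 4"
  have \<gamma>: "0 < \<gamma>" using \<kappa> m by (simp add: \<gamma>_def)
  \<comment> \<open>The new inner semi-axis \<open>\<sigma>\<close> along \<open>v\<close> lies strictly between the outer one, \<open>1 / sqrt (1 + \<eta>)\<close>,
      and the old inner one.\<close>
  have "1 / sqrt (1 + \<eta>) < 1" using \<eta> by simp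
  then obtain \<sigma> where \<sigma>': "1 / sqrt (1 + \<eta>) < \<sigma>" and \<sigma>1: "\<sigma> < 1" using dense by blast
  have "0 < 1 / sqrt (1 + \<eta>)" using \<eta> by simp
  then have \<sigma>0: "0 < \<sigma>" using \<sigma>' by linarith
  have "1 < sqrt (1 + \<eta>) * \<sigma>" using \<sigma>' \<eta> by (simp add: divide_less_eq mult.commute)
  then have "1 < (sqrt (1 + \<eta>) * \<sigma>)\<^sup>2" by (intro one_less_power) auto
  then have \<sigma>\<eta>: "1 < (1 + \<eta>) * \<sigma>\<^sup>2" using \<eta> by (simp add: power_mult_distrib)
  define M where "M = R\<^sup>2 / (\<sigma> * (1 - \<sigma>))"
  have M: "0 \<le> M" using \<sigma>0 \<sigma>1 by (simp add: M_def)
  obtain \<epsilon> where \<epsilon>: "0 < \<epsilon>" "\<epsilon> \<le> 1 / 2" "\<sigma> \<le> (1 - \<epsilon>)\<^sup>2" "M * \<epsilon>\<^sup>2 < 1"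
    "1 + \<epsilon> * \<gamma> \<le> (1 - \<epsilon>) * ((1 + \<eta>) * \<sigma>\<^sup>2)" "1 < (1 - M * \<epsilon>\<^sup>2)\<^sup>2 * (1 + \<epsilon> * \<gamma>)"
    using small_parameter[OF \<sigma>1 \<sigma>\<eta> \<gamma> M] by metis
  \<comment> \<open>The inner ellipsoid has semi-axes \<open>q * a b\<close>; the factor \<open>q\<close> pays for the uncontrolled
      \<open>v\<close>-coordinates of the lifted points.\<close>
  define q where "q = 1 - M * \<epsilon>\<^sup>2"
  have q: "0 < q" "q \<le> 1" using \<epsilon> M by (auto simp: q_def)
  define t where "t b = (1 - \<epsilon>) + \<epsilon> / f b" for b
  have t: "0 < t b" if "b \<in> B0" for b
    using \<epsilon> f[OF that] by (smt (verit) t_def divide_pos_pos field_sum_of_halves)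
  define a where "a b = (if b = v then \<sigma> else t b)" for b
  have a: "0 < a b" if "b \<in> B" for b using that t \<sigma>0 by (auto simp: a_def B_def)
  define g where "g b = 1 / (q * a b)" for b
  have g: "0 < g b" if "b \<in> B" for b using a[OF that] q by (simp add: g_def)
  define \<beta> where "\<beta> b = \<epsilon> * \<kappa> * (f b)\<^sup>2" for b
  have \<beta>: "0 < \<beta> b" if "b \<in> B0" for b
    unfolding \<beta>_def using f[OF that] \<epsilon> \<kappa> by (intro mult_pos_pos) auto
  \<comment> \<open>The new outer centre minimizes the weighted sum of the two outer quadratic polynomials.\<close>
  define h where "h b = (if b = v then c' \<bullet> v
      else ((1 - \<epsilon>) * (c' \<bullet> b) + \<beta> b * (k' \<bullet> b)) / ((1 - \<epsilon>) + \<beta> b))" for b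
  define c2 where "c2 = (\<Sum>b\<in>B. h b *\<^sub>R b)"
  have c2: "c2 \<in> U" "\<And>b. b \<in> B \<Longrightarrow> c2 \<bullet> b = h b"
    unfolding c2_def using coordinates_mem[OF B] coordinates_inner[OF B] by auto
  define L where "L = 1 + \<epsilon> * \<gamma>"
  have L: "0 < L" unfolding L_def using \<epsilon> \<gamma> by (intro add_pos_pos) auto
  define \<rho>'' where "\<rho>'' = \<rho> / (q * sqrt L)"
  have qL: "1 < q\<^sup>2 * L" using \<epsilon> by (simp add: q_def L_def)
  have "1 < q * sqrt L"
  proof (rule power2_less_imp_less)
    show "1\<^sup>2 < (q * sqrt L)\<^sup>2" using qL L by (simp add: power_mult_distrib)
  qed (use q L in simp)
  then have \<rho>'': "\<rho>'' < \<rho>" using \<rho> by (simp add: \<rho>''_def divide_less_eq)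
  have \<rho>''0: "0 \<le> \<rho>''" unfolding \<rho>''_def using \<rho> q L by simp

  have "x \<in> K" if x: "x \<in> U" "norm (diag B g (x - \<epsilon> *\<^sub>R k)) \<le> 1" for x
  proof -
    define Y where "Y b = q * (g b * ((x - \<epsilon> *\<^sub>R k) \<bullet> b))" for b
    have Y: "(x - \<epsilon> *\<^sub>R k) \<bullet> b = a b * Y b" if "b \<in> B" for b
      using a[OF that] q by (simp add: Y_def g_def)
    have "(\<Sum>b\<in>B. (Y b)\<^sup>2) = q\<^sup>2 * (norm (diag B g (x - \<epsilon> *\<^sub>R k)))\<^sup>2"
      by (simp add: norm_diag[OF B] Y_def power_mult_distrib sum_distrib_left)
    also have "\<dots> \<le> q\<^sup>2 * 1" using x(2) by (intro mult_left_mono power_le_one) auto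
    finally have Yq: "(\<Sum>b\<in>B0. (Y b)\<^sup>2) + (Y v)\<^sup>2 \<le> q\<^sup>2" by (simp add: sumB)
    have P1: "(\<Sum>b\<in>B0. (Y b)\<^sup>2) \<le> 1"
      using Yq power_le_one[of q 2] q by (smt (verit) zero_le_power2)
    \<comment> \<open>\<open>x\<close> is to be the combination, with weights \<open>1 - \<epsilon>\<close> and \<open>\<epsilon>\<close>, of a point \<open>w + s' v\<close> of the unit ball
        and a lift \<open>z\<close> of the point \<open>k + z0\<close> of the inner ellipsoid in the hyperplane.\<close>
    define w where "w = (\<Sum>b\<in>B0. Y b *\<^sub>R b)"
    have w: "w \<in> W" "\<And>b. b \<in> B0 \<Longrightarrow> w \<bullet> b = Y b"
      unfolding w_def using coordinates_mem[OF B0] coordinates_inner[OF B0] by auto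
    have w2: "(norm w)\<^sup>2 = (\<Sum>b\<in>B0. (Y b)\<^sup>2)"
      using norm_orthonormal_basis[OF B0 w(1)] w(2) by simp
    define z0 where "z0 = (\<Sum>b\<in>B0. (Y b / f b) *\<^sub>R b)"
    have z0: "z0 \<in> W" "\<And>b. b \<in> B0 \<Longrightarrow> z0 \<bullet> b = Y b / f b"
      unfolding z0_def using coordinates_mem[OF B0] coordinates_inner[OF B0] by auto
    have "(norm (S z0))\<^sup>2 = (\<Sum>b\<in>B0. (Y b)\<^sup>2)"
      unfolding Sf[OF z0(1)] norm_diag[OF B0]
      by (intro sum.cong refl) (use f z0 in force)
    then have "(norm (S z0))\<^sup>2 \<le> 1\<^sup>2" using P1 by simp
    then have "norm (S z0) \<le> 1" by (rule power2_le_imp_le) simp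
    then have "k + z0 \<in> ellipsoid W S k 1"
      using W k z0 by (simp add: ellipsoid_def subspace_add)
    then obtain z where z: "z \<in> K" "k + z0 = z - (z \<bullet> v) *\<^sub>R v" using Sin by blast
    have "\<bar>z \<bullet> v\<bar> \<le> norm z * norm v" by (rule Cauchy_Schwarz_ineq2)
    then have zR: "\<bar>z \<bullet> v\<bar> \<le> R" using R[OF z(1)] v by simp
    have zb: "z \<bullet> b = k \<bullet> b + Y b / f b" if "b \<in> B0" for b
    proof -
      have "(k + z0) \<bullet> b = z \<bullet> b" unfolding z(2) using bv[OF that] by (simp add: inner_diff_left)
      then show ?thesis using z0(2)[OF that] by (simp add: inner_add_left)
    qed
    define s' where "s' = (\<sigma> * Y v - \<epsilon> * (z \<bullet> v)) / (1 - \<epsilon>)"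
    have "(\<sigma> * Y v - \<epsilon> * (z \<bullet> v))\<^sup>2 \<le> (1 - \<epsilon>)\<^sup>2 * (1 - (norm w)\<^sup>2)"
      using tilt_bound[of \<sigma> \<epsilon> R "z \<bullet> v" "(norm w)\<^sup>2" "Y v"] \<sigma>0 \<sigma>1 \<epsilon> zR Yq w2
      by (simp add: M_def q_def)
    then have "s'\<^sup>2 \<le> 1 - (norm w)\<^sup>2"
      using \<epsilon> by (simp add: s'_def power_divide divide_le_eq mult.commute)
    moreover have "(norm (w + s' *\<^sub>R v))\<^sup>2 = (norm w)\<^sup>2 + s'\<^sup>2"
      using w(1) vv unfolding power2_norm_eq_inner W_def
      by (simp add: inner_add_left inner_add_right inner_commute power2_eq_square)
    ultimately have "(norm (w + s' *\<^sub>R v))\<^sup>2 \<le> 1\<^sup>2" by simp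
    then have "norm (w + s' *\<^sub>R v) \<le> 1" by (rule power2_le_imp_le) simp
    moreover have "w + s' *\<^sub>R v \<in> U" using w(1) v U by (simp add: W_def subspace_add subspace_scale)
    ultimately have "w + s' *\<^sub>R v \<in> K" by (intro inner)
    then have comb: "(1 - \<epsilon>) *\<^sub>R (w + s' *\<^sub>R v) + \<epsilon> *\<^sub>R z \<in> K"
      using K(1) z(1) \<epsilon> by (intro convexD) auto
    have "x = (1 - \<epsilon>) *\<^sub>R (w + s' *\<^sub>R v) + \<epsilon> *\<^sub>R z"
    proof (rule orthonormal_basis_eqI[OF B x(1)])
      show "(1 - \<epsilon>) *\<^sub>R (w + s' *\<^sub>R v) + \<epsilon> *\<^sub>R z \<in> U" using comb K by blast
      fix b assume b: "b \<in> B"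
      have xb: "x \<bullet> b = a b * Y b + \<epsilon> * (k \<bullet> b)" using Y[OF b] by (simp add: inner_diff_left)
      show "x \<bullet> b = ((1 - \<epsilon>) *\<^sub>R (w + s' *\<^sub>R v) + \<epsilon> *\<^sub>R z) \<bullet> b"
      proof (cases "b = v")
        case True
        have "k \<bullet> v = 0" "w \<bullet> v = 0" using k w by (auto simp: W_def)
        moreover have "(1 - \<epsilon>) * s' = \<sigma> * Y v - \<epsilon> * (z \<bullet> v)" using \<epsilon> by (simp add: s'_def)
        ultimately show ?thesis using xb vv True by (simp add: a_def inner_add_left)
      next
        case False
        then have b0: "b \<in> B0" using b by (simp add: B_def)
        show ?thesis
          unfolding xb using False bv[OF b0]
          by (simp add: a_def t_def inner_add_left w(2)[OF b0] zb[OF b0] algebra_simps)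
      qed
    qed
    with comb show ?thesis by simp
  qed
  then have in2: "ellipsoid U (diag B g) (\<epsilon> *\<^sub>R k) 1 \<subseteq> K" by (auto simp: ellipsoid_def)

  have "norm (diag B g (x - c2)) \<le> \<rho>''" if x: "x \<in> K" for x
  proof (rule power2_le_imp_le[OF _ \<rho>''0])
    have xU: "x \<in> U" using x K by blast
    have 1: "(1 + \<eta>) * ((x - c') \<bullet> v)\<^sup>2 + (\<Sum>b\<in>B0. ((x - c') \<bullet> b)\<^sup>2) \<le> \<rho>\<^sup>2"
      using outer[OF x] norm_orthonormal_basis[OF B subspace_diff[OF U xU c']]
      by (simp add: sumB algebra_simps)
    define p where "p = x - (x \<bullet> v) *\<^sub>R v"
    have p: "p \<in> W" "norm (S (p - k')) \<le> \<rho>'"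
      using Sout x unfolding p_def ellipsoid_def by auto
    have pb: "(p - k') \<bullet> b = x \<bullet> b - k' \<bullet> b" if "b \<in> B0" for b
      using bv[OF that] by (simp add: p_def inner_diff_left)
    have "(\<Sum>b\<in>B0. (f b)\<^sup>2 * (x \<bullet> b - k' \<bullet> b)\<^sup>2) = (norm (S (p - k')))\<^sup>2"
      unfolding Sf[OF subspace_diff[OF W p(1) k(2)]] norm_diag[OF B0]
      by (intro sum.cong refl) (simp add: pb power_mult_distrib)
    also have "\<dots> \<le> \<rho>'\<^sup>2" using p(2) by (intro power_mono) auto
    finally have "\<epsilon> * \<kappa> * (\<Sum>b\<in>B0. (f b)\<^sup>2 * (x \<bullet> b - k' \<bullet> b)\<^sup>2) \<le> \<epsilon> * \<kappa> * \<rho>'\<^sup>2"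
      using \<epsilon> \<kappa> by (intro mult_left_mono) auto
    also have "\<dots> = \<epsilon> * \<rho>\<^sup>2" using \<rho> by (simp add: \<kappa>_def power_divide)
    finally have 2: "(\<Sum>b\<in>B0. \<beta> b * (x \<bullet> b - k' \<bullet> b)\<^sup>2) \<le> \<epsilon> * \<rho>\<^sup>2"
      by (simp add: \<beta>_def sum_distrib_left mult.assoc)
    \<comment> \<open>Coordinate by coordinate, the new quadratic form is dominated by the combination of the old ones
        with weights \<open>1 - \<epsilon>\<close> and \<open>\<epsilon> * \<kappa>\<close>; the factor \<open>\<kappa>\<close> turns the bound \<open>\<rho>'\<^sup>2\<close> into \<open>\<rho>\<^sup>2\<close>.\<close>
    have "L * q\<^sup>2 * (norm (diag B g (x - c2)))\<^sup>2 = (\<Sum>b\<in>B. L / (a b)\<^sup>2 * (x \<bullet> b - h b)\<^sup>2)"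
      unfolding norm_diag[OF B] sum_distrib_left
      by (intro sum.cong refl)
        (use q in \<open>simp add: c2 g_def inner_diff_left power_mult_distrib power_divide\<close>)
    also have "\<dots> \<le> (1 - \<epsilon>) * ((1 + \<eta>) * ((x - c') \<bullet> v)\<^sup>2)
        + (\<Sum>b\<in>B0. (1 - \<epsilon>) * ((x - c') \<bullet> b)\<^sup>2 + \<beta> b * (x \<bullet> b - k' \<bullet> b)\<^sup>2)"
      unfolding sumB
    proof (intro add_mono sum_mono)
      have "L / \<sigma>\<^sup>2 \<le> (1 - \<epsilon>) * (1 + \<eta>)"
        using \<epsilon>(5) \<sigma>0 by (simp add: L_def divide_le_eq mult.assoc)
      then have "L / \<sigma>\<^sup>2 * ((x - c') \<bullet> v)\<^sup>2 \<le> (1 - \<epsilon>) * (1 + \<eta>) * ((x - c') \<bullet> v)\<^sup>2"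
        by (rule mult_right_mono) simp
      then show "L / (a v)\<^sup>2 * (x \<bullet> v - h v)\<^sup>2 \<le> (1 - \<epsilon>) * ((1 + \<eta>) * ((x - c') \<bullet> v)\<^sup>2)"
        by (simp add: a_def h_def inner_diff_left mult.assoc)
    next
      fix b assume b: "b \<in> B0"
      then have bn: "b \<noteq> v" using vB by blast
      have "m\<^sup>2 \<le> (f b)\<^sup>2" using m(2)[OF b] m(1) by (intro power_mono) auto
      then have "4 * \<gamma> \<le> (\<kappa> - 1) * (f b)\<^sup>2" using \<kappa> by (simp add: \<gamma>_def mult_left_mono)
      then have "L / (t b)\<^sup>2 \<le> (1 - \<epsilon>) + \<beta> b"
        unfolding L_def t_def \<beta>_def
        using \<epsilon> \<kappa> by (intro weighted_mean_harmonic_bound f[OF b]) auto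
      then have "L / (a b)\<^sup>2 * (x \<bullet> b - h b)\<^sup>2 \<le> ((1 - \<epsilon>) + \<beta> b) * (x \<bullet> b - h b)\<^sup>2"
        using bn by (intro mult_right_mono) (auto simp: a_def)
      also have "\<dots> \<le> (1 - \<epsilon>) * (x \<bullet> b - c' \<bullet> b)\<^sup>2 + \<beta> b * (x \<bullet> b - k' \<bullet> b)\<^sup>2"
        using weighted_squares_complete[of "1 - \<epsilon>" "\<beta> b" "x \<bullet> b" "c' \<bullet> b" "k' \<bullet> b"] \<beta>[OF b] \<epsilon> bn
        by (simp add: h_def)
      finally show "L / (a b)\<^sup>2 * (x \<bullet> b - h b)\<^sup>2
          \<le> (1 - \<epsilon>) * ((x - c') \<bullet> b)\<^sup>2 + \<beta> b * (x \<bullet> b - k' \<bullet> b)\<^sup>2"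
        by (simp add: inner_diff_left)
    qed
    also have "\<dots> = (1 - \<epsilon>) * ((1 + \<eta>) * ((x - c') \<bullet> v)\<^sup>2 + (\<Sum>b\<in>B0. ((x - c') \<bullet> b)\<^sup>2))
        + (\<Sum>b\<in>B0. \<beta> b * (x \<bullet> b - k' \<bullet> b)\<^sup>2)"
      by (simp add: sum.distrib sum_distrib_left distrib_left)
    also have "\<dots> \<le> (1 - \<epsilon>) * \<rho>\<^sup>2 + \<epsilon> * \<rho>\<^sup>2"
      using 1 2 \<epsilon> by (intro add_mono mult_left_mono) auto
    finally have "L * q\<^sup>2 * (norm (diag B g (x - c2)))\<^sup>2 \<le> \<rho>\<^sup>2" by (simp add: algebra_simps)
    then show "(norm (diag B g (x - c2)))\<^sup>2 \<le> \<rho>''\<^sup>2"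
      using q L by (simp add: \<rho>''_def power_divide power_mult_distrib le_divide_eq mult.commute mult.left_commute)
  qed
  then have out2: "K \<subseteq> ellipsoid U (diag B g) c2 \<rho>''" using K by (auto simp: ellipsoid_def)
  have "inj_on (diag B g) U" by (rule inj_on_diag[OF B]) (auto dest: g)
  moreover have "\<epsilon> *\<^sub>R k \<in> U" using k U by (simp add: W_def subspace_scale)
  ultimately have "sandwich U K (diag B g) (\<epsilon> *\<^sub>R k) c2 \<rho>''"
    unfolding sandwich_def using in2 out2 c2(1) by (intro conjI linear_diag)
  then show ?thesis using \<rho>'' by blast
qed

text \<open>The general case reduces to the normalized one by the affine map that takes the inner ellipsoid to the
unit ball: it is diagonal in a basis containing \<open>v\<close>, and so it commutes with the projection along \<open>v\<close>.\<close>

lemma better_ratio_from_hyperplane: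
  fixes K U :: "'a::euclidean_space set" and v :: 'a
  defines "W \<equiv> {x \<in> U. x \<bullet> v = 0}"
  assumes K: "convex K" "bounded K" "K \<subseteq> U"
    and B: "orthonormal_basis B U" and v: "v \<in> B"
    and fg: "\<And>b. b \<in> B \<Longrightarrow> 0 < f b" "\<And>b. b \<in> B \<Longrightarrow> f b \<le> g b" "f v < g v"
    and c: "c \<in> U" "c' \<in> U"
    and inner: "ellipsoid U (diag B f) c 1 \<subseteq> K" and outer: "K \<subseteq> ellipsoid U (diag B g) c' \<rho>"
    and \<rho>: "0 < \<rho>'" "\<rho>' < \<rho>"
    and s: "sandwich W ((\<lambda>x. x - (x \<bullet> v) *\<^sub>R v) ` K) S k k' \<rho>'"
  shows "\<exists>S c c' \<rho>''. \<rho>'' < \<rho> \<and> sandwich U K S c c' \<rho>''"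
proof -
  note U = orthonormal_basis_subspace[OF B]
  have vv: "v \<bullet> v = 1" using orthonormal_basis_inner[OF B v v] by simp
  have vU: "v \<in> U" "norm v = 1" using orthonormal_basis_mem[OF B v] vv by (auto simp: norm_eq_1)
  note W = dim_hyperplane_section_less(1)[OF U vU, folded W_def]
  let ?D = "diag B f" and ?E = "diag B (\<lambda>b. 1 / f b)" and ?P = "\<lambda>x. x - (x \<bullet> v) *\<^sub>R v"
  have f0: "f b \<noteq> 0" if "b \<in> B" for b using fg(1)[OF that] by simp
  have DE: "?D (?E x) = x" and ED: "?E (?D x) = x" if "x \<in> U" for x
    using diag_inverse[OF B, of f x] f0 that by auto
  have Dv: "?D x \<bullet> v = f v * (x \<bullet> v)" "?E x \<bullet> v = (x \<bullet> v) / f v" for x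
    using diag_inner[OF B v] by auto
  have DP: "?D (?P x) = ?P (?D x)" if "x \<in> U" for x
  proof (rule orthonormal_basis_eqI[OF B])
    fix b assume "b \<in> B"
    then show "?D (?P x) \<bullet> b = ?P (?D x) \<bullet> b"
      using orthonormal_basis_inner[OF B v] by (simp add: diag_inner[OF B] inner_diff_left algebra_simps v)
  qed (use U vU in \<open>auto simp: diag_mem[OF B] subspace_diff subspace_scale\<close>)
  \<comment> \<open>In the new coordinates the inner ellipsoid is the unit ball of \<open>U\<close>, centred at the origin.\<close>
  let ?K = "(\<lambda>x. ?D x + - ?D c) ` K"
  have KD: "?D (x - c) \<in> ?K" if "x \<in> K" for x
    using that by (intro image_eqI[of _ _ x]) (auto simp: linear_diff)
  have "\<exists>S k k'. sandwich W (?P ` ?K) S k k' \<rho>'"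
  proof -
    have im: "?D ` W = W"
    proof
      show "W \<subseteq> ?D ` W"
      proof
        fix x assume "x \<in> W"
        then have "?E x \<in> W" "x = ?D (?E x)" by (auto simp: W_def diag_mem[OF B] Dv DE)
        then show "x \<in> ?D ` W" by blast
      qed
    qed (auto simp: W_def diag_mem[OF B] Dv)
    have inj: "inj_on ?D W" by (rule inj_on_subset[OF inj_on_diag[OF B]]) (auto simp: W_def dest: f0)
    have mem: "- ?P (?D c) \<in> W"
      unfolding W_def using U vU vv
      by (auto simp: inner_diff_left intro!: subspace_neg subspace_diff subspace_scale diag_mem[OF B])
    obtain S' where "sandwich W ((\<lambda>x. ?D x + - ?P (?D c)) ` (?P ` K)) S'
        (?D k + - ?P (?D c)) (?D k' + - ?P (?D c)) \<rho>'"
      by (rule sandwich_affine_image[OF W linear_diag inj im mem s])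
    moreover have "(\<lambda>x. ?D x + - ?P (?D c)) ` (?P ` K) = ?P ` ?K"
      unfolding image_image
    proof (intro image_cong refl)
      fix x assume "x \<in> K"
      then have "?D (?P x) = ?P (?D x)" using K by (intro DP) auto
      then show "?D (?P x) + - ?P (?D c) = ?P (?D x + - ?D c)"
        by (simp add: inner_diff_left algebra_simps)
    qed
    ultimately show ?thesis by auto
  qed
  then obtain S1 k1 k1' where s1: "sandwich W (?P ` ?K) S1 k1 k1' \<rho>'" by blast
  define \<eta> where "\<eta> = (g v / f v)\<^sup>2 - 1"
  have "1 < g v / f v" using fg v by simp
  then have \<eta>: "0 < \<eta>" unfolding \<eta>_def using one_less_power[of "g v / f v" 2] by simp
  have "\<exists>S c c' \<rho>''. \<rho>'' < \<rho> \<and> sandwich U ?K S c c' \<rho>''"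
  proof (rule better_ratio_from_hyperplane_normalized[OF U _ _ _ vU _ \<eta> _ _ \<rho> s1[unfolded W_def], of "?D (c' - c)"])
    have "?K = (+) (- ?D c) ` ?D ` K" by (auto simp: image_image)
    moreover have "convex (?D ` K)" "bounded (?D ` K)"
      using K by (auto intro!: convex_linear_image bounded_linear_image
          simp: linear_conv_bounded_linear[symmetric])
    ultimately show "convex ?K" "bounded ?K"
      by (simp_all only: convex_translation bounded_translation)
    show "?K \<subseteq> U" using diag_mem[OF B] by (auto intro!: subspace_diff[OF U])
    show "?D (c' - c) \<in> U" by (rule diag_mem[OF B])
  next
    fix y assume y: "y \<in> U" "norm y \<le> 1"
    have "c + ?E y \<in> ellipsoid U ?D c 1"
      using y c U diag_mem[OF B] by (simp add: ellipsoid_def subspace_add DE)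
    then have "c + ?E y \<in> K" using inner by blast
    from KD[OF this] show "y \<in> ?K" using y by (simp add: DE)
  next
    fix y assume "y \<in> ?K"
    then obtain x where x: "x \<in> K" "y = ?D x - ?D c" by auto
    have y: "y - ?D (c' - c) = ?D (x - c')" by (simp add: x linear_diff)
    have "(norm (y - ?D (c' - c)))\<^sup>2 + \<eta> * ((y - ?D (c' - c)) \<bullet> v)\<^sup>2
        = (\<Sum>b\<in>B. (f b * ((x - c') \<bullet> b))\<^sup>2) + ((g v)\<^sup>2 - (f v)\<^sup>2) * ((x - c') \<bullet> v)\<^sup>2"
      unfolding y norm_diag[OF B] Dv \<eta>_def using f0[OF v]
      by (simp add: power_divide field_simps)
    also have "\<dots> \<le> (\<Sum>b\<in>B. (g b * ((x - c') \<bullet> b))\<^sup>2)"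
    proof -
      have fin: "finite B" by (rule orthonormal_basis_finite[OF B])
      have "(\<Sum>b\<in>B - {v}. (f b * ((x - c') \<bullet> b))\<^sup>2) \<le> (\<Sum>b\<in>B - {v}. (g b * ((x - c') \<bullet> b))\<^sup>2)"
        unfolding power_mult_distrib
        using fg by (intro sum_mono mult_right_mono power_mono) (auto intro: less_imp_le)
      from this[unfolded power_mult_distrib] show ?thesis
        unfolding sum.remove[OF fin v] power_mult_distrib left_diff_distrib by linarith
    qed
    also have "\<dots> \<le> \<rho>\<^sup>2"
      unfolding norm_diag[OF B, symmetric] using outer x by (intro power_mono) (auto simp: ellipsoid_def)
    finally show "(norm (y - ?D (c' - c)))\<^sup>2 + \<eta> * ((y - ?D (c' - c)) \<bullet> v)\<^sup>2 \<le> \<rho>\<^sup>2" .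
  qed
  then obtain S2 c2 c2' \<rho>'' where s2: "\<rho>'' < \<rho>" "sandwich U ?K S2 c2 c2' \<rho>''" by blast
  have "inj_on ?E U" "?E ` U = U"
    using inj_on_diag[OF B, of "\<lambda>b. 1 / f b"] diag_image[OF B, of "\<lambda>b. 1 / f b"] f0 by auto
  then obtain S3 where "sandwich U ((\<lambda>x. ?E x + c) ` ?K) S3 (?E c2 + c) (?E c2' + c) \<rho>''"
    by (rule sandwich_affine_image[OF U linear_diag _ _ c(1) s2(2)])
  moreover have "(\<lambda>x. ?E x + c) ` ?K = K"
  proof -
    have "(\<lambda>x. ?E x + c) ` ?K = (\<lambda>x. x) ` K"
      unfolding image_image by (intro image_cong refl) (use K c ED in \<open>auto simp: linear_diff\<close>)
    then show ?thesis by simp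
  qed
  ultimately show ?thesis using s2(1) by auto
qed

section \<open>Projections of minimal dimension\<close>

lemma orthogonal_projection_onto_norm_le:
  assumes "orthogonal_projection_onto U \<pi>"
  shows "norm (\<pi> x) \<le> norm x"
proof -
  have "\<pi> x \<in> U" using assms by (auto simp: orthogonal_projection_onto_def linear_projection_onto_def)
  then have "orthogonal (x - \<pi> x) (\<pi> x)" using assms by (auto simp: orthogonal_projection_onto_def)
  then have "(norm (\<pi> x))\<^sup>2 = x \<bullet> \<pi> x" by (simp add: orthogonal_def inner_diff_left power2_norm_eq_inner)
  also have "\<dots> \<le> norm x * norm (\<pi> x)" by (rule norm_cauchy_schwarz)
  finally have "norm (\<pi> x) * norm (\<pi> x) \<le> norm x * norm (\<pi> x)" by (simp add: power2_eq_square)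
  then show ?thesis by (cases "\<pi> x = 0") (auto simp: mult_le_cancel_right)
qed

text \<open>Orthogonal projections map balls to balls of the same radius, so a pair of balls survives with the
same ratio.\<close>

lemma ball_sandwich_projection:
  fixes \<pi> :: "'a::euclidean_space \<Rightarrow> 'a"
  assumes s: "sandwich UNIV K (\<lambda>x. x /\<^sub>R r) c c' \<rho>" and r: "0 < r"
    and \<pi>: "orthogonal_projection_onto U \<pi>"
  shows "sandwich U (\<pi> ` K) (\<lambda>x. x /\<^sub>R r) (\<pi> c) (\<pi> c') \<rho>"
proof -
  have lin: "linear \<pi>" and U: "\<And>x. \<pi> x \<in> U" "\<And>x. x \<in> U \<Longrightarrow> \<pi> x = x"
    using \<pi> by (auto simp: orthogonal_projection_onto_def linear_projection_onto_def)
  have inn: "ellipsoid UNIV (\<lambda>x. x /\<^sub>R r) c 1 \<subseteq> K"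
    and out: "K \<subseteq> ellipsoid UNIV (\<lambda>x. x /\<^sub>R r) c' \<rho>"
    and S: "linear (\<lambda>x::'a. x /\<^sub>R r)" "inj (\<lambda>x::'a. x /\<^sub>R r)" using s by (auto simp: sandwich_def)
  have "ellipsoid U (\<lambda>x. x /\<^sub>R r) (\<pi> c) 1 \<subseteq> \<pi> ` K"
  proof
    fix y assume y: "y \<in> ellipsoid U (\<lambda>x. x /\<^sub>R r) (\<pi> c) 1"
    then have "c + (y - \<pi> c) \<in> K" using inn by (auto simp: ellipsoid_def)
    moreover have "\<pi> (c + (y - \<pi> c)) = y"
      using y by (simp add: linear_add[OF lin] linear_diff[OF lin] U ellipsoid_def)
    ultimately show "y \<in> \<pi> ` K" by (metis imageI)
  qed
  moreover have "\<pi> ` K \<subseteq> ellipsoid U (\<lambda>x. x /\<^sub>R r) (\<pi> c') \<rho>"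
  proof (intro subsetI, elim imageE)
    fix y x assume y: "y = \<pi> x" and "x \<in> K"
    then have "norm ((x - c') /\<^sub>R r) \<le> \<rho>" using out by (auto simp: ellipsoid_def)
    moreover have "norm (\<pi> (x - c') /\<^sub>R r) \<le> norm ((x - c') /\<^sub>R r)"
      using orthogonal_projection_onto_norm_le[OF \<pi>, of "x - c'"] r by (simp add: mult_left_mono)
    ultimately show "y \<in> ellipsoid U (\<lambda>x. x /\<^sub>R r) (\<pi> c') \<rho>"
      using U by (simp add: y ellipsoid_def linear_diff[OF lin])
  qed
  ultimately show ?thesis
    unfolding sandwich_def using U S(1) inj_on_subset[OF S(2)] by blast
qed

lemma orthogonal_projection_onto_hyperplane:
  assumes U: "subspace U" and v: "v \<in> U" "norm v = 1" and \<pi>: "orthogonal_projection_onto U \<pi>"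
  shows "orthogonal_projection_onto {x \<in> U. x \<bullet> v = 0} (\<lambda>x. \<pi> x - (\<pi> x \<bullet> v) *\<^sub>R v)"
proof -
  have lin: "linear \<pi>" and \<pi>U: "\<And>x. \<pi> x \<in> U" "\<And>x. x \<in> U \<Longrightarrow> \<pi> x = x"
    and orth: "\<And>x y. y \<in> U \<Longrightarrow> (x - \<pi> x) \<bullet> y = 0"
    using \<pi> by (auto simp: orthogonal_projection_onto_def linear_projection_onto_def orthogonal_def)
  have vv: "v \<bullet> v = 1" using v by (simp add: dot_square_norm)
  let ?p = "\<lambda>x. \<pi> x - (\<pi> x \<bullet> v) *\<^sub>R v" and ?W = "{x \<in> U. x \<bullet> v = 0}"
  have "linear ?p"
    by (rule linearI) (auto simp: linear_add[OF lin] linear_scale[OF lin] inner_add_left algebra_simps)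
  moreover have mem: "?p x \<in> ?W" for x
    using \<pi>U v vv U by (simp add: subspace_diff subspace_scale inner_diff_left)
  moreover have fix_W: "?p x = x" if "x \<in> ?W" for x using that \<pi>U(2)[of x] by simp
  moreover have "range ?p = ?W" using mem fix_W by (metis (no_types, lifting) image_subset_iff rangeI subsetI subset_antisym)
  moreover have "(x - ?p x) \<bullet> y = 0" if "y \<in> ?W" for x y
    using that orth[of y x] by (simp add: inner_diff_left inner_commute[of v y])
  ultimately show ?thesis
    unfolding orthogonal_projection_onto_def linear_projection_onto_def orthogonal_def by blast
qed

text \<open>If the distance ellipsoids of a projection with image of minimal dimension were not unique, averaging two
pairs would produce a direction \<open>v\<close> with strict slack. By minimality, projecting further along \<open>v\<close> lowers
the distance, and the perturbation argument turns this into a pair of too small a ratio.\<close>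

lemma unique_orthogonal_projection:
  fixes K :: "'a::euclidean_space set"
  defines "d \<equiv> banach_mazur_dist UNIV K (cball 0 1)"
  assumes K: "convex K" "bounded K" and d: "0 < d" and r: "0 < r"
    and s: "sandwich UNIV K (\<lambda>x. x /\<^sub>R r) c c' d"
  shows "\<exists>U \<pi>. subspace U \<and> orthogonal_projection_onto U \<pi> \<and>
           banach_mazur_dist U (\<pi> ` K) (cball 0 1 \<inter> U) = d \<and>
           (\<exists>!P. distance_ellipsoids U (\<pi> ` K) P)"
proof -
  let ?good = "\<lambda>(U, \<pi>). subspace U \<and> orthogonal_projection_onto U \<pi> \<and>
           banach_mazur_dist U (\<pi> ` K) (cball 0 1 \<inter> U) = d"
  have "?good (UNIV, \<lambda>x. x)"
    by (auto simp: d_def orthogonal_projection_onto_def linear_projection_onto_def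
        linear_id[unfolded id_def] orthogonal_def)
  \<comment> \<open>A projection with image of least dimension among those that preserve the distance.\<close>
  then obtain U\<pi> where good: "?good U\<pi>"
    and least: "\<And>y. ?good y \<Longrightarrow> dim (fst U\<pi>) \<le> dim (fst y)"
    using ex_has_least_nat[of ?good "(UNIV, \<lambda>x. x)" "\<lambda>y. dim (fst y)"] by blast
  obtain U \<pi> where U\<pi>: "U\<pi> = (U, \<pi>)" by fastforce
  have U: "subspace U" and \<pi>: "orthogonal_projection_onto U \<pi>"
    and dU: "d = banach_mazur_dist U (\<pi> ` K) (cball 0 1 \<inter> U)" using good by (auto simp: U\<pi>)
  have lin: "linear \<pi>" and \<pi>U: "\<And>x. \<pi> x \<in> U"
    using \<pi> by (auto simp: orthogonal_projection_onto_def linear_projection_onto_def)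
  have K': "convex (\<pi> ` K)" "bounded (\<pi> ` K)" "\<pi> ` K \<subseteq> U"
    using K lin \<pi>U by (auto intro!: convex_linear_image bounded_linear_image
        simp: linear_conv_bounded_linear[symmetric])
  note sU = ball_sandwich_projection[OF s r \<pi>]
  have min: "d \<le> \<rho>'" if "sandwich U (\<pi> ` K) S k k' \<rho>'" for S k k' \<rho>'
    using banach_mazur_dist_le[OF U that] dU by simp
  let ?E = "ellipsoid U (\<lambda>x. x /\<^sub>R r) (\<pi> c) 1" and ?F = "ellipsoid U (\<lambda>x. x /\<^sub>R r) (\<pi> c') d"
  have "\<exists>!P. distance_ellipsoids U (\<pi> ` K) P"
  proof (rule ex1I)
    show "distance_ellipsoids U (\<pi> ` K) (?E, ?F)"
      unfolding distance_ellipsoids_iff[OF U dU d] using sU by blast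
    fix P assume "distance_ellipsoids U (\<pi> ` K) P"
    moreover obtain E F where "P = (E, F)" by (cases P)
    ultimately obtain S c2 c2' where s2: "sandwich U (\<pi> ` K) S c2 c2' d"
      and P: "P = (ellipsoid U S c2 1, ellipsoid U S c2' d)"
      using distance_ellipsoids_iff[OF U dU d, of E F] by blast
    show "P = (?E, ?F)"
    proof (rule ccontr)
      assume "P \<noteq> (?E, ?F)"
      then have neq: "\<not> (ellipsoid U S c2 1 = ?E \<and> ellipsoid U S c2' d = ?F)" by (simp add: P)
      show False
      proof (rule strict_sandwich_of_two_sandwiches[OF U K'(1) r sU s2 min neq])
        fix B v f g k k' assume B: "orthonormal_basis B U" and v: "v \<in> B"
          and fg: "\<And>b. b \<in> B \<Longrightarrow> 0 < (f b :: real)" "\<And>b. b \<in> B \<Longrightarrow> f b \<le> g b" "f v < g v"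
          and k: "k \<in> U" "k' \<in> U" "ellipsoid U (diag B f) k 1 \<subseteq> \<pi> ` K"
            "\<pi> ` K \<subseteq> ellipsoid U (diag B g) k' d"
        have "v \<bullet> v = 1" using orthonormal_basis_inner[OF B v v] by simp
        then have vU: "v \<in> U" "norm v = 1" using orthonormal_basis_mem[OF B v] by (auto simp: norm_eq_1)
        let ?W = "{x \<in> U. x \<bullet> v = 0}" and ?p = "\<lambda>x. x - (x \<bullet> v) *\<^sub>R v"
        note W = dim_hyperplane_section_less[OF U vU]
        note \<pi>W = orthogonal_projection_onto_hyperplane[OF U vU \<pi>]
        have img: "(\<lambda>x. \<pi> x - (\<pi> x \<bullet> v) *\<^sub>R v) ` K = ?p ` \<pi> ` K" by (simp add: image_image)
        note sW = ball_sandwich_projection[OF s r \<pi>W, unfolded img]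
        have "banach_mazur_dist ?W (?p ` \<pi> ` K) (cball 0 1 \<inter> ?W) = d"
        proof (rule antisym[OF banach_mazur_dist_le[OF W(1) sW]], rule ccontr)
          assume "\<not> d \<le> banach_mazur_dist ?W (?p ` \<pi> ` K) (cball 0 1 \<inter> ?W)"
          then obtain S' l l' \<rho>' where s': "sandwich ?W (?p ` \<pi> ` K) S' l l' \<rho>'" "\<rho>' < d"
            by (elim sandwich_below[OF W(1) sW, OF not_le_imp_less])
          \<comment> \<open>The perturbation argument divides by the smaller ratio, so it is kept positive.\<close>
          have "sandwich ?W (?p ` \<pi> ` K) S' l l' (max \<rho>' (d / 2))"
            using s'(1) by (rule sandwich_mono) simp
          then have "\<exists>S c c' \<rho>''. \<rho>'' < d \<and> sandwich U (\<pi> ` K) S c c' \<rho>''"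
            using s'(2) d by (intro better_ratio_from_hyperplane[OF K' B v fg k]) auto
          then show False using min by fastforce
        qed
        then have "dim U \<le> dim ?W"
          using least[of "(?W, \<lambda>x. \<pi> x - (\<pi> x \<bullet> v) *\<^sub>R v)"] W(1) \<pi>W img by (simp add: U\<pi>)
        then show False using W(2) by simp
      qed
    qed
  qed
  then show ?thesis using U \<pi> dU by blast
qed

text \<open>A linear map takes an optimal pair to a pair of balls; the orthogonal projection obtained there
becomes an oblique one when it is pulled back.\<close>

lemma unique_linear_projection:
  fixes K :: "'a::euclidean_space set"
  defines "d \<equiv> banach_mazur_dist UNIV K (cball 0 1)"
  assumes K: "convex_body K" and d: "0 < d"
  shows "\<exists>U \<pi>. subspace U \<and> linear_projection_onto U \<pi> \<and>
           banach_mazur_dist U (\<pi> ` K) (cball 0 1 \<inter> U) = d \<and>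
           (\<exists>!P. distance_ellipsoids U (\<pi> ` K) P)"
proof -
  have K': "convex K" "bounded K" "K \<noteq> {}"
    using K by (auto simp: convex_body_def compact_eq_bounded_closed)
  obtain S c c' where s: "sandwich UNIV K S c c' d"
    using optimal_sandwich_exists[OF K] by (auto simp: d_def)
  have S: "linear S" "inj S" and inn: "ellipsoid UNIV S c 1 \<subseteq> K" and out: "K \<subseteq> ellipsoid UNIV S c' d"
    using s by (auto simp: sandwich_def)
  obtain T where T: "linear T" "\<And>x. T (S x) = x"
    using linear_injective_left_inverse[OF S] by (auto simp: fun_eq_iff)
  have "surj S" by (rule linear_inj_imp_surj[OF S])
  then have ST: "S (T y) = y" for y using T(2) by (metis surjD)
  have dS: "banach_mazur_dist UNIV (S ` K) (cball 0 1) = d"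
    using banach_mazur_dist_linear_image[OF S(1) T(1) T(2) ST subspace_UNIV K'(3)]
    by (simp add: d_def \<open>surj S\<close>)
  have "sandwich UNIV (S ` K) (\<lambda>x. x /\<^sub>R 1) (S c) (S c') d"
  proof -
    have "ellipsoid UNIV (\<lambda>x. x /\<^sub>R 1) (S c) 1 \<subseteq> S ` K"
    proof
      fix y assume "y \<in> ellipsoid UNIV (\<lambda>x. x /\<^sub>R 1) (S c) 1"
      then have "norm (S (T y - c)) \<le> 1" by (simp add: ellipsoid_def linear_diff[OF S(1)] ST)
      then have "T y \<in> K" using inn by (auto simp: ellipsoid_def)
      then show "y \<in> S ` K" using ST by (metis imageI)
    qed
    moreover have "S ` K \<subseteq> ellipsoid UNIV (\<lambda>x. x /\<^sub>R 1) (S c') d"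
      using out by (auto simp: ellipsoid_def linear_diff[OF S(1)])
    ultimately show ?thesis by (simp add: sandwich_def linear_id[unfolded id_def])
  qed
  moreover have "convex (S ` K)" "bounded (S ` K)"
    using K' S(1) by (auto intro!: convex_linear_image bounded_linear_image
        simp: linear_conv_bounded_linear[symmetric])
  ultimately have "\<exists>U \<pi>. subspace U \<and> orthogonal_projection_onto U \<pi> \<and>
      banach_mazur_dist U (\<pi> ` S ` K) (cball 0 1 \<inter> U) = d \<and> (\<exists>!P. distance_ellipsoids U (\<pi> ` S ` K) P)"
    using d by (intro unique_orthogonal_projection[of "S ` K" 1 "S c" "S c'", unfolded dS]) simp_all
  then obtain U \<pi> where U: "subspace U" and \<pi>: "linear_projection_onto U \<pi>"
    and dU: "banach_mazur_dist U (\<pi> ` S ` K) (cball 0 1 \<inter> U) = d"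
    and ex1: "\<exists>!P. distance_ellipsoids U (\<pi> ` S ` K) P"
    unfolding orthogonal_projection_onto_def by blast
  have img: "(\<lambda>x. T (\<pi> (S x))) ` K = T ` \<pi> ` S ` K" by (simp add: image_image)
  have ne: "\<pi> ` S ` K \<noteq> {}" using K' by simp
  have "linear (\<lambda>x. T (\<pi> (S x)))"
    using linear_compose[OF linear_compose[OF S(1), of \<pi>] T(1)] \<pi>
    by (simp add: linear_projection_onto_def o_def)
  moreover have "range (\<lambda>x. T (\<pi> (S x))) = T ` U"
  proof -
    have "range (\<lambda>x. T (\<pi> (S x))) = T ` \<pi> ` range S" by (simp add: image_image)
    then show ?thesis using \<pi> by (simp add: \<open>surj S\<close> linear_projection_onto_def)
  qed
  moreover have "T (\<pi> (S x)) = x" if x: "x \<in> T ` U" for x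
  proof -
    obtain u where "u \<in> U" "x = T u" using x by blast
    moreover have "\<pi> u = u" if "u \<in> U" for u using \<pi> that by (simp add: linear_projection_onto_def)
    ultimately show ?thesis by (simp add: ST)
  qed
  ultimately have "linear_projection_onto (T ` U) (\<lambda>x. T (\<pi> (S x)))"
    by (simp add: linear_projection_onto_def)
  moreover have "subspace (T ` U)" using linear_subspace_image[OF T(1) U] .
  moreover have "banach_mazur_dist (T ` U) ((\<lambda>x. T (\<pi> (S x))) ` K) (cball 0 1 \<inter> T ` U) = d"
    unfolding img using banach_mazur_dist_linear_image[OF T(1) S(1) ST T(2) U ne] dU by simp
  moreover have "\<exists>!P. distance_ellipsoids (T ` U) ((\<lambda>x. T (\<pi> (S x))) ` K) P"
    unfolding img
    using unique_distance_ellipsoids_linear_image[OF T(1) S(1) ST T(2) U _ ne ex1] dU d by simp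
  ultimately show ?thesis by blast
qed

text \<open>The outer ellipsoid of the pair is a dilate of the inner ball and hence a ball as well. The radius is
positive because ellipsoids are non-degenerate.\<close>

lemma ball_sandwich_of_distance_balls:
  fixes K :: "'a::euclidean_space set"
  defines "d \<equiv> banach_mazur_dist UNIV K (cball 0 1)"
  assumes E: "distance_ellipsoids UNIV K (cball c r, F)" and d: "0 < d"
  obtains c' where "0 < r" "sandwich UNIV K (\<lambda>x. x /\<^sub>R r) c c' d"
proof -
  obtain t where ell: "ellipsoid_in UNIV (cball c r)" and F: "F = (+) t ` (*\<^sub>R) d ` cball c r"
    and sub: "cball c r \<subseteq> K" "K \<subseteq> F"
    using E by (auto simp: distance_ellipsoids_def d_def)
  obtain S k where S: "linear S" "inj S" and cb: "cball c r = ellipsoid UNIV S k 1"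
    using ell by (auto simp: ellipsoid_in_iff)
  have r: "0 < r"
  proof (rule ccontr)
    assume "\<not> 0 < r"
    obtain e :: 'a where e: "e \<noteq> 0" using nonzero_Basis nonempty_Basis by blast
    have Se: "S e \<noteq> 0" using e S by (metis injD linear_0)
    have "k \<in> cball c r" by (simp add: cb ellipsoid_def linear_0[OF S(1)])
    moreover have "k + e /\<^sub>R norm (S e) \<in> cball c r"
      using Se by (simp add: cb ellipsoid_def linear_scale[OF S(1)])
    ultimately have "k = c" "k + e /\<^sub>R norm (S e) = c"
      using \<open>\<not> 0 < r\<close> by (smt (verit) mem_cball zero_le_dist dist_eq_0_iff)+
    then show False using e Se by simp
  qed
  note n = norm_rescaled_diff_le_iff[OF r]
  have "linear (\<lambda>x::'a. x /\<^sub>R r)" "inj (\<lambda>x::'a. x /\<^sub>R r)"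
    using r by (auto simp: inj_on_def linear_scale_self)
  moreover have "ellipsoid UNIV (\<lambda>x. x /\<^sub>R r) c 1 \<subseteq> K"
    using sub(1) by (auto simp: ellipsoid_def n subset_iff simp del: norm_scaleR)
  moreover have "K \<subseteq> ellipsoid UNIV (\<lambda>x. x /\<^sub>R r) (t + d *\<^sub>R c) d"
  proof
    fix x assume "x \<in> K"
    then obtain e where e: "dist c e \<le> r" "x = t + d *\<^sub>R e" using sub(2) by (auto simp: F)
    have "dist (t + d *\<^sub>R c) x = d * dist c e"
      using d by (simp add: e(2) dist_norm flip: scaleR_diff_right)
    then show "x \<in> ellipsoid UNIV (\<lambda>x. x /\<^sub>R r) (t + d *\<^sub>R c) d"
      using e d by (simp add: ellipsoid_def n mult_left_mono del: norm_scaleR)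
  qed
  ultimately have "sandwich UNIV K (\<lambda>x. x /\<^sub>R r) c (t + d *\<^sub>R c) d" by (simp add: sandwich_def)
  then show thesis using r that by blast
qed

theorem theorem6p3:
  fixes K :: "(real ^ 'n) set"
  assumes "convex_body K"
  shows "(\<exists>U \<pi>. subspace U \<and> linear_projection_onto U \<pi> \<and>
            banach_mazur_dist U (\<pi> ` K) (cball 0 1 \<inter> U) = banach_mazur_dist UNIV K (cball 0 1) \<and>
            (\<exists>!P. distance_ellipsoids U (\<pi> ` K) P)) \<and>
         ((\<exists>c r c' r'. distance_ellipsoids UNIV K (cball c r, cball c' r')) \<longrightarrow>
          (\<exists>U \<pi>. subspace U \<and> orthogonal_projection_onto U \<pi> \<and>
            banach_mazur_dist U (\<pi> ` K) (cball 0 1 \<inter> U) = banach_mazur_dist UNIV K (cball 0 1) \<and>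
            (\<exists>!P. distance_ellipsoids U (\<pi> ` K) P)))"
proof (intro conjI impI)
  let ?d = "banach_mazur_dist UNIV K (cball 0 1)"
  obtain S c c' where "sandwich UNIV K S c c' ?d"
    using optimal_sandwich_exists[OF assms] by blast
  moreover have "UNIV \<noteq> {0 :: real ^ 'n}" using nonempty_Basis nonzero_Basis by blast
  ultimately have "1 \<le> ?d" using sandwich_ratio(1)[OF subspace_UNIV] by blast
  then have d: "0 < ?d" by simp
  show "\<exists>U \<pi>. subspace U \<and> linear_projection_onto U \<pi> \<and>
      banach_mazur_dist U (\<pi> ` K) (cball 0 1 \<inter> U) = ?d \<and> (\<exists>!P. distance_ellipsoids U (\<pi> ` K) P)"
    by (rule unique_linear_projection[OF assms d])
  assume "\<exists>c r c' r'. distance_ellipsoids UNIV K (cball c r, cball c' r')"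
  then obtain c r c' r' where "distance_ellipsoids UNIV K (cball c r, cball c' r')" by blast
  then obtain k' where "0 < r" "sandwich UNIV K (\<lambda>x. x /\<^sub>R r) c k' ?d"
    using ball_sandwich_of_distance_balls[OF _ d] by blast
  moreover have "convex K" "bounded K"
    using assms by (auto simp: convex_body_def compact_eq_bounded_closed)
  ultimately show "\<exists>U \<pi>. subspace U \<and> orthogonal_projection_onto U \<pi> \<and>
      banach_mazur_dist U (\<pi> ` K) (cball 0 1 \<inter> U) = ?d \<and> (\<exists>!P. distance_ellipsoids U (\<pi> ` K) P)"
    using unique_orthogonal_projection d by blast
qed

end
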